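(* Let $f:\mathbb{R}\to\mathbb{R}$ be $C^2$ and suppose the ODE $\dot{x}=f(x)$ has a hyperbolic attracting rest point at $x=a$ whose basin of attraction $D$ has a boundary consisting of either one or two hyperbolic unstable rest points. Write $D=(\alpha,\beta)$, where $-\infty\le\alpha<a<\beta\le\infty$ and at least one of $\alpha,\beta$ is finite. Let $R=\min\{a-\alpha,\beta-a\}$. Define $$\mu_-=\begin{cases}\max\{f(x): x\in[\alpha,a]\} & \text{if }\alpha\neq-\infty\\ \infty & \text{otherwise}\end{cases},\qquad \mu_+=\begin{cases}-\min\{f(x): x\in[a,\beta]\} & \text{if }\beta\neq\infty\\ \infty & \text{otherwise}\end{cases},$$ and $\mu=\min\{\mu_-,\mu_+\}$. Fix a constant $L>R$. Let $\Lambda_L$ be the set of functions $\lambda:\mathbb{R}\to\mathbb{R}$ satisfying all of the following conditions: $\lambda$ is globally Lipschitz continuous; $\lim_{t\to-\infty}\lambda(t)=0$; $\lim_{t\to\infty}\lambda(t)$ exists and is finite; $\int_{-\infty}^{\infty}|\dot{\lambda}(t)|\,dt=L$; there exists $T$ such that $\lambda$ restricted to $(T,\infty)$ is $C^2$; and there exists a number $\rho>0$ such that $\lim_{t\to\infty}\frac{\ddot{\lambda}(t)}{e^{-\rho t}}$ exists (and is finite). Then there exists a number $m_c>\mu$ (depending on $f$, $a$ and $L$, but not on $\lambda$) such that: (i) if $\lambda\in\Lambda_L$ induces tipping in the ODE $\dot{x}=f(x+\lambda(t))$, then $|\dot{\lambda}(t)|\ge m_c$ for at least one $t$; (ii) there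 exists $\lambda\in\Lambda_L$ which induces tipping in $\dot{x}=f(x+\lambda(t))$ and satisfies $\max_t|\dot{\lambda}(t)|=m_c$; (iii) viewed as a function of $L\in(R,\infty)$, $m_c$ is continuous and strictly decreasing and satisfies $\lim_{L\to R}m_c=\infty$ and $\lim_{L\to\infty}m_c=\mu$.
   Context: A globally Lipschitz $\lambda$ is differentiable almost everywhere with essentially bounded measurable derivative; $\dot{\lambda}(t)$ refers to points $t$ where $\lambda$ is differentiable, and "for at least one $t$" and "$\max_t$" range over such points. Solutions of $\dot{y}=f(y)+u(t)$ with $u$ measurable and essentially bounded are understood in the Carathéodory sense: (locally) absolutely continuous functions satisfying $y(t)=y(t_0)+\int_{t_0}^t \big(f(y(s))+u(s)\big)\,ds$, defined on their maximal interval of existence. Induces tipping: let $\hat{y}$ be the unique solution of $\dot{y}=f(y)+\dot{\lambda}(t)$ with $\lim_{t\to-\infty}\hat{y}(t)=a$ (equivalently, under the change of coordinates $y=x+\lambda$, $\hat{y}=\hat{x}+\lambda$, where $\hat{x}$ is the unique solution of $\dot{x}=f(x+\lambda(t))$ with $\lim_{t\to-\infty}\hat{x}(t)=a$). Then $\lambda$ induces tipping in $\dot{x}=f(x+\lambda(t))$ if and only if it is not the case that $\lim_{t\to\infty}\hat{y}(t)=a$. In particular, convergence $\lim_{t\to\infty}\hat{y}(t)\in\partial D$ and escape of $\hat{y}$ from $\overline{D}$ (including finite-time blow-up) both count as tipping. A rest point $p$ of $\dot{x}=f(x)$ is hyperbolic if $f'(p)\neq 0$. *)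

theory Defs
  imports "HOL-Analysis.Analysis"
begin

text \<open>Twice continuous differentiability on a set \<open>S\<close>; only used for open \<open>S\<close>.\<close>

definition C2_on :: "(real \<Rightarrow> real) \<Rightarrow> real set \<Rightarrow> bool" where
  "C2_on f S \<longleftrightarrow>
     (\<forall>x\<in>S. f differentiable (at x) \<and> deriv f differentiable (at x)) \<and>
     continuous_on S (deriv (deriv f))"

definition forward_solution :: "(real \<Rightarrow> real) \<Rightarrow> real \<Rightarrow> (real \<Rightarrow> real) \<Rightarrow> bool" where
  "forward_solution f x0 x \<longleftrightarrow>
     x 0 = x0 \<and> (\<forall>t\<ge>0. (x has_real_derivative f (x t)) (at t within {0..}))"

definition basin :: "(real \<Rightarrow> real) \<Rightarrow> real \<Rightarrow> real set" where
  "basin f p = {x0. \<exists>x. forward_solution f x0 x \<and> (x \<longlongrightarrow> p) at_top}"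

definition rest_point :: "(real \<Rightarrow> real) \<Rightarrow> real \<Rightarrow> bool" where
  "rest_point f p \<longleftrightarrow> f p = 0"

definition hyperbolic :: "(real \<Rightarrow> real) \<Rightarrow> real \<Rightarrow> bool" where
  "hyperbolic f p \<longleftrightarrow> rest_point f p \<and> deriv f p \<noteq> 0"

text \<open>Lyapunov stability. For locally Lipschitz \<open>f\<close> solutions are unique, so the existential
  over \<open>x\<close> speaks about the trajectory starting at \<open>x0\<close>, and includes its global existence.\<close>

definition stable :: "(real \<Rightarrow> real) \<Rightarrow> real \<Rightarrow> bool" where
  "stable f p \<longleftrightarrow>
     (\<forall>e>0. \<exists>d>0. \<forall>x0. \<bar>x0 - p\<bar> < d \<longrightarrow>
        (\<exists>x. forward_solution f x0 x \<and> (\<forall>t\<ge>0. \<bar>x t - p\<bar> < e)))"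

definition attracting :: "(real \<Rightarrow> real) \<Rightarrow> real \<Rightarrow> bool" where
  "attracting f p \<longleftrightarrow> stable f p \<and> (\<exists>e>0. ball p e \<subseteq> basin f p)"

text \<open>Caratheodory solutions of \<open>y' = f(y) + u(t)\<close> on an interval \<open>J\<close>, in Lebesgue integral form;
  the integral equation makes \<open>y\<close> locally absolutely continuous on \<open>J\<close>. Values of \<open>y\<close> outside
  \<open>J\<close>, and values of \<open>u\<close> on a null set, are irrelevant.\<close>

definition caratheodory_solution ::
    "(real \<Rightarrow> real) \<Rightarrow> (real \<Rightarrow> real) \<Rightarrow> real set \<Rightarrow> (real \<Rightarrow> real) \<Rightarrow> bool" where
  "caratheodory_solution f u J y \<longleftrightarrow>
     is_interval J \<and>
     (\<forall>t0\<in>J. \<forall>t\<in>J. t0 \<le> t \<longrightarrow>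
        (\<lambda>s. f (y s) + u s) absolutely_integrable_on {t0..t} \<and>
        y t = y t0 + integral {t0..t} (\<lambda>s. f (y s) + u s))"

definition maximal_solution ::
    "(real \<Rightarrow> real) \<Rightarrow> (real \<Rightarrow> real) \<Rightarrow> real set \<Rightarrow> (real \<Rightarrow> real) \<Rightarrow> bool" where
  "maximal_solution f u J y \<longleftrightarrow>
     caratheodory_solution f u J y \<and>
     (\<forall>J' y'. caratheodory_solution f u J' y' \<and> J \<subseteq> J' \<and> (\<forall>t\<in>J. y' t = y t) \<longrightarrow> J' = J)"

definition pullback_solution ::
    "(real \<Rightarrow> real) \<Rightarrow> (real \<Rightarrow> real) \<Rightarrow> real \<Rightarrow> real set \<Rightarrow> (real \<Rightarrow> real) \<Rightarrow> bool" where
  "pullback_solution f u a J y \<longleftrightarrow>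
     maximal_solution f u J y \<and> (\<exists>T. {..T} \<subseteq> J) \<and> (y \<longlongrightarrow> a) at_bot"

text \<open>The solution \<open>y\<close> below is unique on its maximal interval \<open>J\<close> when \<open>a\<close> is hyperbolic and
  attracting and \<open>lam\<close> is Lipschitz and tends to \<open>0\<close> at \<open>-\<infinity>\<close>. Since \<open>J\<close> is an interval
  containing a left half-line, \<open>J = UNIV\<close> says that there is no finite-time blow-up.
  \<open>deriv lam t\<close> is an unspecified constant where \<open>lam\<close> is not differentiable, which for
  Lipschitz \<open>lam\<close> is a null set.\<close>

definition induces_tipping :: "(real \<Rightarrow> real) \<Rightarrow> real \<Rightarrow> (real \<Rightarrow> real) \<Rightarrow> bool" where
  "induces_tipping f a lam \<longleftrightarrow>
     (\<exists>J y. pullback_solution f (deriv lam) a J y \<and> \<not> (J = UNIV \<and> (y \<longlongrightarrow> a) at_top))"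

definition Lambda :: "real \<Rightarrow> (real \<Rightarrow> real) set" where
  "Lambda L = {lam.
     (\<exists>C. C-lipschitz_on UNIV lam) \<and>
     (lam \<longlongrightarrow> 0) at_bot \<and>
     (\<exists>l. (lam \<longlongrightarrow> l) at_top) \<and>
     ((\<lambda>t. \<bar>deriv lam t\<bar>) has_integral L) UNIV \<and>
     (\<exists>T. C2_on lam {T<..}) \<and>
     (\<exists>\<rho>>0. \<exists>l. ((\<lambda>t. deriv (deriv lam) t / exp (- \<rho> * t)) \<longlongrightarrow> l) at_top)}"

text \<open>The interval endpoints \<open>\<alpha>\<close>, \<open>\<beta>\<close> are extended reals, at least one of them finite, so the
  minimum defining the radius is a finite number.\<close>

definition basin_radius :: "real \<Rightarrow> ereal \<Rightarrow> ereal \<Rightarrow> real" where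
  "basin_radius a \<alpha> \<beta> = real_of_ereal (min (ereal a - \<alpha>) (\<beta> - ereal a))"

text \<open>For continuous \<open>f\<close> the supremum and infimum are over compact intervals, hence attained.\<close>

definition mu_minus :: "(real \<Rightarrow> real) \<Rightarrow> real \<Rightarrow> ereal \<Rightarrow> ereal" where
  "mu_minus f a \<alpha> =
     (if \<alpha> \<noteq> -\<infinity> then ereal (SUP x\<in>{real_of_ereal \<alpha>..a}. f x) else \<infinity>)"

definition mu_plus :: "(real \<Rightarrow> real) \<Rightarrow> real \<Rightarrow> ereal \<Rightarrow> ereal" where
  "mu_plus f a \<beta> =
     (if \<beta> \<noteq> \<infinity> then ereal (- (INF x\<in>{a..real_of_ereal \<beta>}. f x)) else \<infinity>)"

definition mu :: "(real \<Rightarrow> real) \<Rightarrow> real \<Rightarrow> ereal \<Rightarrow> ereal \<Rightarrow> ereal" where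
  "mu f a \<alpha> \<beta> = min (mu_minus f a \<alpha>) (mu_plus f a \<beta>)"

end

theory Submission
  imports Defs
begin

text \<open>
Write \<open>u\<close> for the rate of change of the input and consider the right-hand boundary \<open>\<beta>\<close> of the basin.
At a position \<open>x\<close> between \<open>a\<close> and \<open>\<beta>\<close> we have \<open>f x < 0\<close>, so \<open>u\<close> moves the solution to the right with
speed \<open>f x + u\<close> while it consumes total variation at rate \<open>\<bar>u\<bar>\<close>. The variation spent per unit
length is \<open>u / (f x + u)\<close>, which is decreasing in \<open>u\<close>: under the constraint \<open>\<bar>u\<bar> \<le> m\<close> it is cheapest
to use the maximal rate \<open>m\<close> all the way. The least total variation that carries the solution from
\<open>a\<close> to \<open>\<beta>\<close> is therefore the integral of \<open>m / (m + f x)\<close> over \<open>{a..\<beta>}\<close> (\<open>crossing_price\<close>). The critical rate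
for a path of length \<open>L\<close> is the rate at which the cheaper of the two boundaries costs exactly \<open>L\<close>.

No tipping below the critical rate: integrating the optimal weight \<open>w = m / (m + f)\<close> gives a
function \<open>V\<close> of position that increases along the solution strictly more slowly than the variation is spent
(\<open>crossing_cost\<close>). A solution that starts at \<open>a\<close> is thus kept at a positive distance from each finite boundary
point, and bounded on an infinite side (\<open>cost_barrier\<close>). Being confined to a compact part of the basin it exists for all
time (\<open>bounded_maximal_solution_is_global\<close>), and as the input is integrable, the attraction of \<open>a\<close>
wins in the end (\<open>eventually_le_of_attraction\<close>). The chain rule along the solution cannot
be taken pointwise, as the right-hand side is only integrable; \<open>chain_rule_indefinite_integral\<close>
replaces it. That the rate bound holds almost everywhere, including the points at which the
derivative has an unspecified value, is the differentiability almost everywhere of Lipschitz functions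
(\<open>lipschitz_differentiable_ae\<close>).

Tipping at the critical rate: a linear ramp of slope \<open>m\<close> whose length equals the price carries the
solution from \<open>a\<close> to the boundary point in finite time; there the solution
rests (\<open>bang_bang_transit\<close>).

Dependence on \<open>L\<close>: beyond the largest value \<open>\<mu>\<close> of \<open>\<bar>f\<bar>\<close> on the way, the price decreases strictly and
continuously; it tends to the distance to the boundary as \<open>m\<close> grows, and to infinity as
\<open>m\<close> approaches \<open>\<mu>\<close>. Its reciprocal, continued by \<open>0\<close> up to \<open>\<mu>\<close>, is a continuous function on the whole
line (\<open>budget_profile\<close>). With this convention an infinite boundary has the reciprocal price \<open>0\<close>, the
cheaper of the two sides is a maximum, and the critical rate is an inverse function
(\<open>budget_profile_inverse\<close>). The left boundary of \<open>f\<close> is the right boundary of \<open>\<lambda>x. - f (- x)\<close>.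
\<close>

section \<open>Lipschitz functions on the line are differentiable almost everywhere\<close>

text \<open>Adding a steep linear function makes \<open>g\<close> an increasing bi-Lipschitz bijection \<open>F\<close>. The image of Lebesgue measure under the
inverse of \<open>F\<close> gives an interval the length of its \<open>F\<close>-image, and it
vanishes on null sets because \<open>F\<close> is Lipschitz. Its Radon-Nikodym density integrates to the increments of \<open>F\<close>.\<close>

lemma lipschitz_imp_indefinite_integral:
  fixes g :: "real \<Rightarrow> real"
  assumes lip: "C-lipschitz_on UNIV g"
  obtains h where "\<And>a b. a \<le> b \<Longrightarrow> h absolutely_integrable_on {a..b}"
    "\<And>a b. a \<le> b \<Longrightarrow> (h has_integral (g b - g a)) {a..b}"
proof -
  \<comment> \<open>The slope \<open>C + 1\<close> makes every increment of \<open>F\<close> at least that of the identity.\<close>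
  define F where "F t = g t + (C + 1) * t" for t
  have C0: "C \<ge> 0" using lip by (rule lipschitz_on_nonneg)
  have lipg: "\<bar>g x - g y\<bar> \<le> C * \<bar>x - y\<bar>" for x y
    using lipschitz_onD[OF lip, of x y] by (simp add: dist_real_def)
  have incr: "F y - F x \<ge> y - x" if "x \<le> y" for x y
    using lipg[of x y] that unfolding F_def by (simp add: algebra_simps abs_le_iff)
  have Flip: "\<bar>F x - F y\<bar> \<le> (2 * C + 1) * \<bar>x - y\<bar>" for x y
  proof -
    have "F x - F y = (g x - g y) + (C + 1) * (x - y)" by (simp add: F_def algebra_simps)
    then have "\<bar>F x - F y\<bar> \<le> \<bar>g x - g y\<bar> + \<bar>(C + 1) * (x - y)\<bar>" by linarith
    also have "\<bar>(C + 1) * (x - y)\<bar> = (C + 1) * \<bar>x - y\<bar>" using C0 by (simp add: abs_mult)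
    finally show ?thesis using lipg[of x y] by (simp add: algebra_simps)
  qed
  have smono: "strict_mono F"
  proof (rule strict_monoI)
    fix x y :: real assume "x < y" then show "F x < F y" using incr[of x y] by linarith
  qed
  have contF: "continuous_on UNIV F"
    unfolding F_def
    by (intro continuous_intros lipschitz_on_continuous_on[OF lip])
  have surj: "\<exists>x. F x = z" for z
  proof -
    define M where "M = \<bar>z\<bar> + \<bar>F 0\<bar>"
    have M0: "M \<ge> 0" by (simp add: M_def)
    have "F 0 - F (- M) \<ge> M" using incr[of "-M" 0] M0 by simp
    then have 1: "F (- M) \<le> z" unfolding M_def by linarith
    have "F M - F 0 \<ge> M" using incr[of 0 M] M0 by simp
    then have 2: "z \<le> F M" unfolding M_def by linarith
    have "continuous_on {-M..M} F" using contF continuous_on_subset by blast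
    from IVT'[OF 1 2 _ this] show ?thesis by (auto simp: M0)
  qed
  define G where "G = inv F"
  have injF: "inj F" using smono by (rule strict_mono_imp_inj_on)
  have GF: "G (F x) = x" for x unfolding G_def using injF by simp
  have FG: "F (G x) = x" for x unfolding G_def using surj[of x] by (metis f_inv_into_f rangeI)
  have monoG: "mono G"
  proof (rule monoI)
    fix x y :: real assume "x \<le> y"
    then show "G x \<le> G y" by (metis FG smono strict_mono_less_eq)
  qed
  have Gmeas[measurable]: "G \<in> borel_measurable borel" by (rule borel_measurable_mono[OF monoG])
  define M where "M = distr lborel lborel G"
  have emM: "emeasure M A = emeasure lborel (F ` A)" if "A \<in> sets borel" for A
  proof -
    have "G -` A = F ` A" using GF FG by (auto simp: image_iff) (metis FG)
    then show ?thesis unfolding M_def using that by (simp add: emeasure_distr)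
  qed
  have ac: "absolutely_continuous lborel M"
    unfolding absolutely_continuous_def
  proof
    fix A :: "real set" assume A: "A \<in> null_sets lborel"
    then have Ab: "A \<in> sets borel" by auto
    have "negligible A" using A by (simp add: negligible_iff_null_sets null_sets_completionI)
    then have "negligible (F ` A)"
    proof (rule negligible_locally_Lipschitz_image[OF order_refl])
      fix x assume "x \<in> A"
      show "\<exists>T B. open T \<and> x \<in> T \<and> (\<forall>y\<in>A \<inter> T. norm (F y - F x) \<le> B * norm (y - x))"
        using Flip by (intro exI[of _ UNIV] exI[of _ "2*C+1"]) auto
    qed
    moreover have "F ` A \<in> sets borel"
    proof -
      have "G -` A = F ` A" using GF FG by (auto simp: image_iff) (metis FG)
      then show ?thesis using measurable_sets[OF Gmeas Ab] by simp
    qed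
    ultimately have "emeasure lborel (F ` A) = 0"
      by (simp add: negligible_iff_emeasure0 sets_completionI_sets)
    then show "A \<in> null_sets M" using emM[OF Ab] Ab by (auto simp: M_def)
  qed
  have "\<exists>h\<in>borel_measurable lborel. density lborel h = M"
    by (rule sigma_finite_measure.Radon_Nikodym[OF sigma_finite_lborel ac]) (simp add: M_def)
  then obtain h where hm[measurable]: "h \<in> borel_measurable borel" and hM: "density lborel h = M" by auto
  have Icc: "(\<integral>\<^sup>+x. h x * indicator {a..b} x \<partial>lborel) = ennreal (F b - F a)" if "a \<le> b" for a b
  proof -
    have im: "F ` {a..b} = {F a..F b}"
    proof (intro set_eqI iffI)
      fix z assume "z \<in> {F a..F b}"
      then have "F a \<le> F (G z)" "F (G z) \<le> F b" by (auto simp: FG)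
      then have "G z \<in> {a..b}" using smono by (simp add: strict_mono_less_eq)
      then show "z \<in> F ` {a..b}" by (metis FG imageI)
    qed (auto simp: smono strict_mono_less_eq)
    have "(\<integral>\<^sup>+x. h x * indicator {a..b} x \<partial>lborel) = emeasure (density lborel h) {a..b}"
      by (simp add: emeasure_density)
    also have "\<dots> = emeasure lborel {F a..F b}" by (simp add: hM emM im)
    finally show ?thesis using that smono by (simp add: strict_mono_less_eq)
  qed
  define k where "k x = enn2real (h x)" for x
  have kint: "(k has_integral (F b - F a)) {a..b}" if ab: "a \<le> b" for a b
  proof -
    have fin: "AE x in lborel. h x * indicator {a..b} x \<noteq> \<infinity>"
      by (rule nn_integral_PInf_AE) (use Icc[OF ab] in auto)
    have "(\<integral>\<^sup>+x. ennreal (k x * indicator {a..b} x) \<partial>lborel) = (\<integral>\<^sup>+x. h x * indicator {a..b} x \<partial>lborel)"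
    proof (rule nn_integral_cong_AE)
      show "AE x in lborel. ennreal (k x * indicator {a..b} x) = h x * indicator {a..b} x"
        using fin by eventually_elim (auto simp: k_def indicator_def less_top)
    qed
    then have "((\<lambda>x. k x * indicator {a..b} x) has_integral (F b - F a)) UNIV"
      using ab smono by (intro nn_integral_has_integral) (auto simp: k_def Icc strict_mono_less_eq)
    moreover have "(\<lambda>x. k x * indicator {a..b} x) = (\<lambda>x. if x \<in> {a..b} then k x else 0)" by auto
    ultimately show ?thesis by (simp only: has_integral_restrict_UNIV)
  qed
  show thesis
  proof (rule that[of "\<lambda>x. k x - (C + 1)"])
    fix a b :: real assume ab: "a \<le> b"
    have "k absolutely_integrable_on {a..b}"
      by (rule nonnegative_absolutely_integrable_1)
         (use kint[OF ab] in \<open>auto simp: integrable_on_def k_def\<close>)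
    then show "(\<lambda>x. k x - (C + 1)) absolutely_integrable_on {a..b}"
      by (rule set_integral_diff) auto
    have "((\<lambda>x. k x - (C + 1)) has_integral (F b - F a - (b - a) *\<^sub>R (C + 1))) {a..b}"
      using has_integral_diff[OF kint[OF ab] has_integral_const_real[of "C+1" a b]] ab by simp
    then show "((\<lambda>x. k x - (C + 1)) has_integral (g b - g a)) {a..b}"
      by (simp add: F_def algebra_simps)
  qed
qed

text \<open>Lebesgue's differentiation theorem for averages over cubes that have the point as their lower
corner; on the line these averages are the right-hand difference quotients of the integral.\<close>

lemma indefinite_integral_right_quotient:
  fixes h :: "real \<Rightarrow> real"
  assumes int: "\<And>a b. a \<le> b \<Longrightarrow> (h has_integral (g b - g a)) {a..b}"
  obtains N where "negligible N"
    "\<And>x. x \<notin> N \<Longrightarrow> ((\<lambda>z. (g z - g x) / (z - x)) \<longlongrightarrow> h x) (at_right x)"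
proof -
  have "h integrable_on cbox a b" for a b
    using int[of a b] by (cases "a \<le> b") (auto simp: integrable_on_def)
  then obtain N where N: "negligible N"
    "\<And>x e. \<lbrakk>x \<notin> N; 0 < e\<rbrakk> \<Longrightarrow> \<exists>d>0. \<forall>k. 0 < k \<and> k < d \<longrightarrow>
       norm (integral (cbox x (x + k *\<^sub>R One)) h /\<^sub>R k ^ DIM(real) - h x) < e"
    using integrable_ccontinuous_explicit[of h] by metis
  show thesis
  proof (rule that[OF N(1)])
    fix x assume x: "x \<notin> N"
    show "((\<lambda>z. (g z - g x) / (z - x)) \<longlongrightarrow> h x) (at_right x)"
      unfolding tendsto_iff
    proof (intro allI impI)
      fix e :: real assume "e > 0"
      with N(2)[OF x] obtain d where d: "d > 0" "\<And>k. 0 < k \<Longrightarrow> k < d \<Longrightarrow>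
         norm (integral (cbox x (x + k *\<^sub>R One)) h /\<^sub>R k ^ DIM(real) - h x) < e" by blast
      show "\<forall>\<^sub>F z in at_right x. dist ((g z - g x) / (z - x)) (h x) < e"
      proof (rule eventually_at_rightI[of x "x + d"])
        fix z assume z: "z \<in> {x<..<x+d}"
        have "integral {x..z} h = g z - g x"
          using int[of x z] z by (auto intro: integral_unique)
        then show "dist ((g z - g x) / (z - x)) (h x) < e"
          using d(2)[of "z - x"] z by (simp add: dist_real_def divide_inverse mult.commute)
      qed (use d in auto)
    qed
  qed
qed

text \<open>The left-hand quotients of \<open>g\<close> are the right-hand ones of the reflected function, so both
one-sided derivatives exist and equal the density outside a null set.\<close>

lemma lipschitz_differentiable_ae:
  fixes g :: "real \<Rightarrow> real"
  assumes lip: "C-lipschitz_on UNIV g"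
  shows "negligible {t. \<not> g differentiable (at t)}"
    and "deriv g absolutely_integrable_on {p..q}"
proof -
  obtain h where habs: "\<And>a b. a \<le> b \<Longrightarrow> h absolutely_integrable_on {a..b}"
    and int: "\<And>a b. a \<le> b \<Longrightarrow> (h has_integral (g b - g a)) {a..b}"
    using lipschitz_imp_indefinite_integral[OF lip] by blast
  obtain N1 where N1: "negligible N1"
    "\<And>x. x \<notin> N1 \<Longrightarrow> ((\<lambda>z. (g z - g x) / (z - x)) \<longlongrightarrow> h x) (at_right x)"
    using indefinite_integral_right_quotient[OF int] by blast
  have int': "((\<lambda>x. h (- x)) has_integral (- g (- b) - - g (- a))) {a..b}" if "a \<le> b" for a b
    using has_integral_reflect_real[where f=h and a="-b" and b="-a", THEN iffD2, OF int] that
    by simp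
  obtain N2 where N2: "negligible N2"
    "\<And>x. x \<notin> N2 \<Longrightarrow> ((\<lambda>z. (- g (- z) - - g (- x)) / (z - x)) \<longlongrightarrow> h (- x)) (at_right x)"
    using indefinite_integral_right_quotient[of "\<lambda>x. h (-x)" "\<lambda>x. - g (- x)"] int' by blast
  define N where "N = N1 \<union> uminus ` N2"
  have negN: "negligible N"
    unfolding N_def using N1(1) N2(1)
    by (intro negligible_Un negligible_differentiable_image_negligible)
      (auto simp: differentiable_on_def intro!: derivative_intros)
  have der: "(g has_real_derivative h x) (at x)" if "x \<notin> N" for x
  proof -
    have x1: "x \<notin> N1" and x2: "- x \<notin> N2" using that by (auto simp: N_def image_iff)
    have "((\<lambda>z. (g z - g x) / (z - x)) \<longlongrightarrow> h x) (at_left x)"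
      unfolding filterlim_at_left_to_right[of _ _ x]
      by (rule Lim_transform_eventually[OF N2(2)[OF x2, simplified]])
        (auto simp: eventually_at_filter divide_simps algebra_simps intro!: always_eventually)
    then show ?thesis
      unfolding has_field_derivative_iff using N1(2)[OF x1] filterlim_split_at by blast
  qed
  show "negligible {t. \<not> g differentiable (at t)}"
    by (rule negligible_subset[OF negN]) (use der in \<open>auto simp: real_differentiable_def\<close>)
  show "deriv g absolutely_integrable_on {p..q}"
  proof (cases "p \<le> q")
    case True
    show ?thesis
      by (rule absolutely_integrable_spike[OF habs[OF True] negN])
        (use der in \<open>auto intro: DERIV_imp_deriv\<close>)
  qed auto
qed

section \<open>Crossing costs of Caratheodory solutions\<close>

text \<open>This turns the pointwise strict gap between variation spent and ground gained into a strict
inequality of the integrals.\<close>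

lemma integral_strict_mono_ae:
  fixes g1 g2 :: "real \<Rightarrow> real"
  assumes st: "s < t" and int: "g1 integrable_on {s..t}" "g2 integrable_on {s..t}"
    and N: "negligible N" and less: "\<And>x. x \<in> {s..t} - N \<Longrightarrow> g1 x < g2 x"
  shows "integral {s..t} g1 < integral {s..t} g2"
proof -
  define p where "p x = (if x \<in> N then 1 else g2 x - g1 x)" for x
  have "((\<lambda>x. g2 x - g1 x) has_integral (integral {s..t} g2 - integral {s..t} g1)) {s..t}"
    using int by (intro has_integral_diff) auto
  then have hp: "(p has_integral (integral {s..t} g2 - integral {s..t} g1)) {s..t}"
    by (rule has_integral_spike[OF N, rotated]) (auto simp: p_def)
  have ppos: "p x > 0" if "x \<in> {s..t}" for x using less[of x] that by (auto simp: p_def)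
  have "integral {s..t} g2 - integral {s..t} g1 \<ge> 0"
    by (rule has_integral_nonneg[OF hp]) (use ppos less_imp_le in blast)
  moreover have "integral {s..t} g2 - integral {s..t} g1 \<noteq> 0"
  proof
    assume "integral {s..t} g2 - integral {s..t} g1 = 0"
    with hp have "((\<lambda>x. if x \<in> {s..t} then p x else 0) has_integral 0) UNIV"
      by (simp only: has_integral_restrict_UNIV)
    moreover have "0 \<le> (if x \<in> {s..t} then p x else 0)" for x
      using ppos[of x] by auto
    ultimately have m: "(\<lambda>x. if x \<in> {s..t} then p x else 0) \<in> borel_measurable lebesgue"
      and "(\<integral>\<^sup>+x. ennreal (if x \<in> {s..t} then p x else 0) \<partial>lebesgue) = 0"
      using has_integral_iff_nn_integral_lebesgue[of "\<lambda>x. if x \<in> {s..t} then p x else 0" 0] by auto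
    then have "AE x in lebesgue. ennreal (if x \<in> {s..t} then p x else 0) = 0"
      by (subst (asm) nn_integral_0_iff_AE) auto
    then have "AE x in lebesgue. x \<notin> {s..t}"
      by eventually_elim (use ppos in \<open>force split: if_splits\<close>)
    then have "{s..t} \<in> null_sets lebesgue"
      by (subst AE_iff_null_sets) auto
    then have "negligible {s..t}" by (simp add: negligible_iff_null_sets)
    then show False using st negligible_interval(1)[of s t] by (simp add: box_real)
  qed
  ultimately show ?thesis by linarith
qed

lemma mvt_closed_segment:
  fixes V w :: "real \<Rightarrow> real"
  assumes "\<And>x. x \<in> {lo..hi} \<Longrightarrow> (V has_real_derivative w x) (at x within {lo..hi})"
    and "b \<in> {lo..hi}" "c \<in> {lo..hi}"
  shows "\<exists>\<xi>\<in>closed_segment b c. V c - V b = w \<xi> * (c - b)"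
proof -
  have *: "\<exists>\<xi>\<in>{b..c}. V c - V b = w \<xi> * (c - b)" if "b < c" "b \<in> {lo..hi}" "c \<in> {lo..hi}" for b c
  proof -
    have "\<exists>\<xi>\<in>{b<..<c}. V c - V b = (\<lambda>h. w \<xi> * h) (c - b)"
    proof (rule mvt_simple[OF \<open>b < c\<close>])
      fix x assume "b \<le> x" "x \<le> c"
      then have "(V has_real_derivative w x) (at x within {b..c})"
        using that by (intro DERIV_subset[OF assms(1)]) auto
      then show "(V has_derivative (\<lambda>h. w x * h)) (at x within {b..c})"
        by (simp add: has_field_derivative_def)
    qed
    then show ?thesis by force
  qed
  consider "b < c" | "b = c" | "c < b" by linarith
  then show ?thesis
  proof cases
    case 1 then show ?thesis using *[OF 1 assms(2,3)] by (auto simp: closed_segment_eq_real_ivl)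
  next
    case 2 then show ?thesis by auto
  next
    case 3
    then obtain \<xi> where "\<xi> \<in> {c..b}" "V b - V c = w \<xi> * (b - c)" using *[OF 3 assms(3,2)] by auto
    then show ?thesis using 3 by (intro bexI[of _ \<xi>]) (auto simp: closed_segment_eq_real_ivl algebra_simps)
  qed
qed

lemma indefinite_integral_continuous_on:
  fixes y g :: "real \<Rightarrow> real"
  assumes int: "g integrable_on {p..q}"
    and y: "\<And>t. p \<le> t \<Longrightarrow> t \<le> q \<Longrightarrow> y t = y p + integral {p..t} g"
  shows "continuous_on {p..q} y"
  by (rule continuous_on_eq[of _ "\<lambda>t. y p + integral {p..t} g"])
    (auto intro!: continuous_intros indefinite_integral_continuous_1 int y[symmetric])

text \<open>The chain rule for an absolutely continuous \<open>y\<close>, without differentiating \<open>y\<close>. On a short interval the mean value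
theorem writes the increment of \<open>V \<circ> y\<close> as \<open>w (y r)\<close> times the integral of \<open>g\<close>, and \<open>w \<circ> y\<close> oscillates by at most \<open>e\<close>
there; so the error is at most \<open>e\<close> times the integral of \<open>\<bar>g\<bar>\<close>. This bound is additive over adjacent intervals.\<close>

lemma chain_rule_indefinite_integral:
  fixes y g V w :: "real \<Rightarrow> real"
  assumes pq: "p \<le> q" and g: "g absolutely_integrable_on {p..q}"
    and y: "\<And>s t. p \<le> s \<Longrightarrow> s \<le> t \<Longrightarrow> t \<le> q \<Longrightarrow> y t = y s + integral {s..t} g"
    and V: "\<And>x. x \<in> {lo..hi} \<Longrightarrow> (V has_real_derivative w x) (at x within {lo..hi})"
    and w: "continuous_on {lo..hi} w"
    and yin: "\<And>t. p \<le> t \<Longrightarrow> t \<le> q \<Longrightarrow> y t \<in> {lo..hi}"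
  shows "(\<lambda>t. w (y t) * g t) integrable_on {p..q}"
    and "V (y q) - V (y p) = integral {p..q} (\<lambda>t. w (y t) * g t)"
proof -
  have gi: "g integrable_on {p..q}" using g by (rule absolutely_integrable_on_def[THEN iffD1, THEN conjunct1])
  have cy: "continuous_on {p..q} y"
    by (rule indefinite_integral_continuous_on[OF gi y]) auto
  have cwy: "continuous_on {p..q} (\<lambda>t. w (y t))"
    by (rule continuous_on_compose2[OF w cy]) (use yin in auto)
  have m: "(\<lambda>t. w (y t)) \<in> borel_measurable (lebesgue_on {p..q})"
    by (rule continuous_imp_measurable_on_sets_lebesgue[OF cwy]) auto
  have b: "bounded ((\<lambda>t. w (y t)) ` {p..q})"
    by (intro compact_imp_bounded compact_continuous_image cwy) auto
  have wg: "(\<lambda>t. w (y t) * g t) absolutely_integrable_on {p..q}"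
    by (rule absolutely_integrable_bounded_measurable_product_real[OF m _ b g]) simp
  then show wgi: "(\<lambda>t. w (y t) * g t) integrable_on {p..q}"
    by (rule absolutely_integrable_on_def[THEN iffD1, THEN conjunct1])
  have gabs: "(\<lambda>t. \<bar>g t\<bar>) integrable_on {p..q}"
    using g by (auto simp: absolutely_integrable_on_def)
  note sub = integrable_on_subinterval
  define D where "D s t = \<bar>V (y t) - V (y s) - integral {s..t} (\<lambda>t. w (y t) * g t)\<bar>" for s t
  have main: "D p q \<le> e * integral {p..q} (\<lambda>t. \<bar>g t\<bar>)" if e: "e > 0" for e
  proof -
    define P where "P s t \<longleftrightarrow> (p \<le> s \<and> s \<le> t \<and> t \<le> q \<longrightarrow> D s t \<le> e * integral {s..t} (\<lambda>t. \<bar>g t\<bar>))" for s t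
    have "P p q"
    proof (rule Bolzano[OF pq, of P])
      fix r s t assume A: "P r s" "P s t" "r \<le> s" "s \<le> t"
      show "P r t" unfolding P_def
      proof
        assume B: "p \<le> r \<and> r \<le> t \<and> t \<le> q"
        have 1: "integral {r..s} (\<lambda>t. \<bar>g t\<bar>) + integral {s..t} (\<lambda>t. \<bar>g t\<bar>) = integral {r..t} (\<lambda>t. \<bar>g t\<bar>)"
          by (rule Henstock_Kurzweil_Integration.integral_combine[OF _ _ sub[OF gabs]]) (use A B in auto)
        have 2: "integral {r..s} (\<lambda>t. w (y t) * g t) + integral {s..t} (\<lambda>t. w (y t) * g t) = integral {r..t} (\<lambda>t. w (y t) * g t)"
          by (rule Henstock_Kurzweil_Integration.integral_combine[OF _ _ sub[OF wgi]]) (use A B in auto)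
        have "D r t \<le> D r s + D s t" unfolding D_def using 2 by linarith
        also have "\<dots> \<le> e * integral {r..s} (\<lambda>t. \<bar>g t\<bar>) + e * integral {s..t} (\<lambda>t. \<bar>g t\<bar>)"
          using A B unfolding P_def by (intro add_mono) auto
        finally show "D r t \<le> e * integral {r..t} (\<lambda>t. \<bar>g t\<bar>)"
          using 1 by (simp add: distrib_left[symmetric])
      qed
    next
      fix x assume x: "p \<le> x" "x \<le> q"
      with cwy e have "\<exists>d>0. \<forall>t\<in>{p..q}. dist t x < d \<longrightarrow> dist (w (y t)) (w (y x)) < e / 2"
        unfolding continuous_on_iff by (meson atLeastAtMost_iff half_gt_zero)
      then obtain d where d: "d > 0" "\<And>t. p \<le> t \<Longrightarrow> t \<le> q \<Longrightarrow> \<bar>t - x\<bar> < d \<Longrightarrow> \<bar>w (y t) - w (y x)\<bar> < e / 2"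
        by (auto simp: dist_real_def)
      show "\<exists>d>0. \<forall>s t. s \<le> x \<and> x \<le> t \<and> t - s < d \<longrightarrow> P s t"
      proof (intro exI[of _ d] conjI allI impI)
        fix s t assume st: "s \<le> x \<and> x \<le> t \<and> t - s < d"
        show "P s t" unfolding P_def
        proof
          assume B: "p \<le> s \<and> s \<le> t \<and> t \<le> q"
          obtain \<xi> where \<xi>: "\<xi> \<in> closed_segment (y s) (y t)" "V (y t) - V (y s) = w \<xi> * (y t - y s)"
            using mvt_closed_segment[OF V, of "y s" "y t"] yin B by auto
          have "connected (y ` {s..t})"
            using B by (intro connected_continuous_image continuous_on_subset[OF cy]) auto
          then have "convex (y ` {s..t})" by (metis is_interval_connected_1 is_interval_convex_1)
          then have "closed_segment (y s) (y t) \<subseteq> y ` {s..t}"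
            using B by (intro closed_segment_subset) auto
          with \<xi> obtain r where r: "r \<in> {s..t}" "\<xi> = y r" by auto
          have osc: "\<bar>w (y r) - w (y z)\<bar> \<le> e" if z: "z \<in> {s..t}" for z
          proof -
            have "\<bar>r - x\<bar> < d" "\<bar>z - x\<bar> < d" using st r(1) z by auto
            then have "\<bar>w (y r) - w (y x)\<bar> < e / 2" "\<bar>w (y z) - w (y x)\<bar> < e / 2"
              using d(2)[of r] d(2)[of z] B r(1) z by auto
            then show ?thesis by linarith
          qed
          have int1: "g integrable_on {s..t}" "(\<lambda>t. w (y t) * g t) integrable_on {s..t}" "(\<lambda>t. \<bar>g t\<bar>) integrable_on {s..t}"
            using B by (auto intro: sub[OF gi] sub[OF wgi] sub[OF gabs])
          have cint: "(\<lambda>z. w (y r) * g z) integrable_on {s..t}"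
            using integrable_cmul[OF int1(1), of "w (y r)"] by simp
          have "V (y t) - V (y s) = w (y r) * integral {s..t} g"
            using \<xi>(2) r y[of s t] B by simp
          then have "D s t = \<bar>integral {s..t} (\<lambda>z. w (y r) * g z - w (y z) * g z)\<bar>"
            unfolding D_def using integral_diff[OF cint int1(2)] by simp
          also have "\<dots> \<le> integral {s..t} (\<lambda>z. e * \<bar>g z\<bar>)"
          proof -
            have "norm (integral {s..t} (\<lambda>z. w (y r) * g z - w (y z) * g z)) \<le> integral {s..t} (\<lambda>z. e * \<bar>g z\<bar>)"
            proof (rule integral_norm_bound_integral)
              show "(\<lambda>z. w (y r) * g z - w (y z) * g z) integrable_on {s..t}"
                by (rule integrable_diff[OF cint int1(2)])
              fix z assume z: "z \<in> {s..t}"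
              have "\<bar>w (y r) * g z - w (y z) * g z\<bar> = \<bar>w (y r) - w (y z)\<bar> * \<bar>g z\<bar>"
                by (simp add: abs_mult[symmetric] algebra_simps)
              also have "\<dots> \<le> e * \<bar>g z\<bar>" by (rule mult_right_mono[OF osc[OF z]]) auto
              finally show "norm (w (y r) * g z - w (y z) * g z) \<le> e * \<bar>g z\<bar>" by simp
            qed (use integrable_cmul[OF int1(3), of e] in simp)
            then show ?thesis by simp
          qed
          finally show "D s t \<le> e * integral {s..t} (\<lambda>t. \<bar>g t\<bar>)" by simp
        qed
      qed (use d in auto)
    qed
    then show ?thesis using pq by (simp add: P_def)
  qed
  define G where "G = integral {p..q} (\<lambda>t. \<bar>g t\<bar>)"
  have "D p q \<le> 0 + e" if "e > 0" for e
  proof -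
    have G0: "G \<ge> 0" unfolding G_def by (rule integral_nonneg[OF gabs]) auto
    have "D p q \<le> (e / (G + 1)) * G" using main[of "e / (G + 1)"] that G0 by (simp add: G_def)
    also have "\<dots> \<le> e" using that G0 by (simp add: divide_simps)
    finally show ?thesis by simp
  qed
  then have "D p q \<le> 0" by (rule field_le_epsilon)
  then show "V (y q) - V (y p) = integral {p..q} (\<lambda>t. w (y t) * g t)" unfolding D_def by simp
qed

text \<open>Take the first time at level \<open>c\<close>, and before it the last time at level \<open>d\<close>.\<close>

lemma last_crossing:
  fixes y :: "real \<Rightarrow> real"
  assumes cont: "continuous_on {p..q} y" and "p \<le> q" "y p \<le> d" "d < c" "c \<le> y q"
  obtains s t where "p \<le> s" "s < t" "t \<le> q" "y s = d" "y t = c" "\<And>r. s \<le> r \<Longrightarrow> r \<le> t \<Longrightarrow> y r \<in> {d..c}"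
proof -
  have cs: "continuous_on {a..b} y" if "p \<le> a" "b \<le> q" for a b
    using that by (intro continuous_on_subset[OF cont]) auto
  have comp: "compact ({a..b} \<inter> y -` {z})" if "p \<le> a" "b \<le> q" for a b z
  proof -
    have "closed ({a..b} \<inter> y -` {z})" by (rule continuous_closed_preimage[OF cs[OF that]]) auto
    then show ?thesis by (simp add: compact_eq_bounded_closed bounded_Int)
  qed
  have "\<exists>r\<ge>p. r \<le> q \<and> y r = c"
    by (rule IVT') (use assms in auto)
  then have "{p..q} \<inter> y -` {c} \<noteq> {}" by auto
  from compact_attains_inf[OF comp this] obtain t where t: "t \<in> {p..q}" "y t = c"
    "\<And>r. r \<in> {p..q} \<Longrightarrow> y r = c \<Longrightarrow> t \<le> r" by auto
  have "\<exists>r\<ge>p. r \<le> t \<and> y r = d"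
    by (rule IVT') (use assms t cs[of p t] in auto)
  then have "{p..t} \<inter> y -` {d} \<noteq> {}" by auto
  from compact_attains_sup[OF comp this] t obtain s where s: "s \<in> {p..t}" "y s = d"
    "\<And>r. r \<in> {p..t} \<Longrightarrow> y r = d \<Longrightarrow> r \<le> s" by auto
  show thesis
  proof (rule that[of s t])
    show "s < t" using s(1,2) t(2) \<open>d < c\<close> by (cases "s = t") auto
    fix r assume r: "s \<le> r" "r \<le> t"
    have "y r \<le> c"
    proof (rule ccontr)
      assume "\<not> y r \<le> c"
      then have "\<exists>z\<ge>s. z \<le> r \<and> y z = c"
        using s t r \<open>d < c\<close> by (intro IVT' cs) auto
      then obtain z where "s \<le> z" "z \<le> r" "y z = c" by blast
      then have "z = t" using t(3)[of z] s(1) t(1) r by force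
      then show False using \<open>z \<le> r\<close> r \<open>\<not> y r \<le> c\<close> t by auto
    qed
    moreover have "d \<le> y r"
    proof (rule ccontr)
      assume "\<not> d \<le> y r"
      then have "\<exists>z\<ge>r. z \<le> t \<and> y z = d"
        using s t r \<open>d < c\<close> by (intro IVT' cs) auto
      then obtain z where "r \<le> z" "z \<le> t" "y z = d" by blast
      then have "z = s" using s(3)[of z] s(1) t(1) r by force
      then show False using \<open>r \<le> z\<close> r \<open>\<not> d \<le> y r\<close> s by auto
    qed
    ultimately show "y r \<in> {d..c}" by simp
  qed (use s t in auto)
qed

text \<open>First hitting times of increasing levels are ordered in time, which lets the costs of successive
stretches be added.\<close>

lemma first_hitting_time:
  fixes y :: "real \<Rightarrow> real"
  assumes cont: "\<And>P. continuous_on {P..Q} y" and lim: "(y \<longlongrightarrow> a) at_bot" and "a < c" "c \<le> y Q"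
  obtains t where "t \<le> Q" "y t = c" "\<And>r. r < t \<Longrightarrow> y r < c"
proof -
  have "\<forall>\<^sub>F r in at_bot. y r < c" using lim \<open>a < c\<close> by (rule order_tendstoD)
  then obtain P where P: "\<And>r. r \<le> P \<Longrightarrow> y r < c" unfolding eventually_at_bot_linorder by blast
  have PQ: "P < Q" using P[of Q] \<open>c \<le> y Q\<close> by force
  have "closed ({P..Q} \<inter> y -` {c})" by (rule continuous_closed_preimage[OF cont]) auto
  then have comp: "compact ({P..Q} \<inter> y -` {c})" by (simp add: compact_eq_bounded_closed bounded_Int)
  have "\<exists>r\<ge>P. r \<le> Q \<and> y r = c"
    by (rule IVT') (use assms PQ P[of P] in auto)
  then have "{P..Q} \<inter> y -` {c} \<noteq> {}" by auto
  from compact_attains_inf[OF comp this] obtain t where t: "t \<in> {P..Q}" "y t = c"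
    "\<And>r. r \<in> {P..Q} \<Longrightarrow> y r = c \<Longrightarrow> t \<le> r" by auto
  show thesis
  proof (rule that[of t])
    fix r assume r: "r < t"
    show "y r < c"
    proof (rule ccontr)
      assume n: "\<not> y r < c"
      then have "P < r" using P[of r] by force
      then have "\<exists>z\<ge>P. z \<le> r \<and> y z = c"
        using P[of P] n r t by (intro IVT' continuous_on_subset[OF cont[of P]]) auto
      then show False using t r by force
    qed
  qed (use t in auto)
qed

lemma caratheodory_solutionD:
  assumes "caratheodory_solution f u J y" "s \<in> J" "t \<in> J"
  shows "s \<le> r \<Longrightarrow> r \<le> t \<Longrightarrow> r \<in> J"
    and "s \<le> t \<Longrightarrow> (\<lambda>r. f (y r) + u r) absolutely_integrable_on {s..t}"
    and "s \<le> t \<Longrightarrow> y t = y s + integral {s..t} (\<lambda>r. f (y r) + u r)"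
    and "continuous_on {s..t} y"
proof -
  show J: "r \<in> J" if "s \<le> r" "r \<le> t" for r
    using assms that unfolding caratheodory_solution_def is_interval_1 by blast
  show ai: "(\<lambda>r. f (y r) + u r) absolutely_integrable_on {s..t}" if "s \<le> t"
    using assms that unfolding caratheodory_solution_def by blast
  show "y t = y s + integral {s..t} (\<lambda>r. f (y r) + u r)" if "s \<le> t"
    using assms that unfolding caratheodory_solution_def by blast
  show "continuous_on {s..t} y"
  proof (cases "s \<le> t")
    case True
    have eq: "y r = y s + integral {s..r} (\<lambda>r. f (y r) + u r)" if "s \<le> r" "r \<le> t" for r
      using J[OF that] assms that unfolding caratheodory_solution_def by blast
    have gi: "(\<lambda>r. f (y r) + u r) integrable_on {s..t}"
      using ai[OF True] by (simp add: absolutely_integrable_on_def)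
    show ?thesis by (rule indefinite_integral_continuous_on[OF gi eq])
  qed auto
qed

text \<open>A weight \<open>w\<close> with \<open>w (f + u) < \<bar>u\<bar>\<close> prices positions so that every stretch costs strictly more variation
than its price.\<close>

lemma crossing_cost:
  fixes f u y w V :: "real \<Rightarrow> real"
  assumes car: "caratheodory_solution f u J y" and pq: "p \<in> J" "q \<in> J" "p \<le> q"
    and y: "y p \<le> d" "d < c" "c \<le> y q"
    and uint: "u absolutely_integrable_on {p..q}"
    and V: "\<And>x. x \<in> {d..c} \<Longrightarrow> (V has_real_derivative w x) (at x within {d..c})"
    and w: "continuous_on {d..c} w"
    and N: "negligible N" and less: "\<And>x t. x \<in> {d..c} \<Longrightarrow> t \<notin> N \<Longrightarrow> w x * (f x + u t) < \<bar>u t\<bar>"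
  shows "V c - V d < integral {p..q} (\<lambda>t. \<bar>u t\<bar>)"
proof -
  obtain s t where st: "p \<le> s" "s < t" "t \<le> q" "y s = d" "y t = c" "\<And>r. s \<le> r \<Longrightarrow> r \<le> t \<Longrightarrow> y r \<in> {d..c}"
    using last_crossing[OF caratheodory_solutionD(4)[OF car pq(1,2)] pq(3) y] by blast
  have J: "r \<in> J" if "s \<le> r" "r \<le> t" for r
    using caratheodory_solutionD(1)[OF car pq(1,2), of r] that st by auto
  have sJ: "s \<in> J" and tJ: "t \<in> J" using J st by auto
  have uabs: "(\<lambda>t. \<bar>u t\<bar>) integrable_on {p..q}" using uint by (auto simp: absolutely_integrable_on_def)
  then have uabs': "(\<lambda>t. \<bar>u t\<bar>) integrable_on {s..t}" by (rule integrable_on_subinterval) (use st in auto)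
  have g: "(\<lambda>r. f (y r) + u r) absolutely_integrable_on {s..t}"
    by (rule caratheodory_solutionD(2)[OF car sJ tJ]) (use st in simp)
  have inc: "y t' = y s' + integral {s'..t'} (\<lambda>r. f (y r) + u r)" if "s \<le> s'" "s' \<le> t'" "t' \<le> t" for s' t'
  proof -
    have "s' \<in> J" "t' \<in> J" using J that by auto
    then show ?thesis using caratheodory_solutionD(3)[OF car] that(2) by blast
  qed
  note chain = chain_rule_indefinite_integral[OF less_imp_le[OF st(2)] g inc V w st(6)]
  have 1: "(\<lambda>r. w (y r) * (f (y r) + u r)) integrable_on {s..t}" by (rule chain(1))
  have 2: "V (y t) - V (y s) = integral {s..t} (\<lambda>r. w (y r) * (f (y r) + u r))" by (rule chain(2))
  have "integral {s..t} (\<lambda>r. w (y r) * (f (y r) + u r)) < integral {s..t} (\<lambda>t. \<bar>u t\<bar>)"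
    by (rule integral_strict_mono_ae[OF st(2) 1 uabs' N]) (use less st in auto)
  also have "\<dots> \<le> integral {p..q} (\<lambda>t. \<bar>u t\<bar>)"
    by (rule integral_subset_le) (use st uabs uabs' in auto)
  finally show ?thesis using 2 st by simp
qed

text \<open>The strict inequality for single stretches has to survive the limits \<open>d \<rightarrow> a\<close> and \<open>c \<rightarrow> B\<close>. It does, because one fixed stretch,
from \<open>d0\<close> to \<open>c0\<close>, is overpaid by a fixed \<open>\<delta>\<close>. The solution cannot come arbitrarily
close to \<open>B\<close> even when the budget \<open>L\<close> equals the full price.\<close>

lemma cost_barrier:
  fixes f u y w :: "real \<Rightarrow> real"
  assumes car: "caratheodory_solution f u J y" and J: "{..T} \<subseteq> J" and lim: "(y \<longlongrightarrow> a) at_bot"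
    and aB: "a < B" and w: "continuous_on {a..B} w"
    and N: "negligible N" and less: "\<And>x t. a < x \<Longrightarrow> x < B \<Longrightarrow> t \<notin> N \<Longrightarrow> w x * (f x + u t) < \<bar>u t\<bar>"
    and uint: "\<And>p q. u absolutely_integrable_on {p..q}"
    and L: "\<And>p q. integral {p..q} (\<lambda>t. \<bar>u t\<bar>) \<le> L" and Lw: "L \<le> integral {a..B} w"
  shows "\<exists>B'>a. B' < B \<and> (\<forall>t\<in>J. y t \<le> B')"
proof (rule ccontr)
  assume "\<not> ?thesis"
  then have reach: "\<exists>t\<in>J. y t > c" if "a < c" "c < B" for c using that by force
  define V where "V x = integral {a..x} w" for x
  have V: "(V has_real_derivative w x) (at x within {a..B})" if "x \<in> {a..B}" for x
    unfolding V_def by (rule integral_has_real_derivative[OF w that])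
  have dn: "r \<in> J" if "r \<le> t" "t \<in> J" for r t
  proof -
    have "min r T \<in> J" using J by auto
    then show ?thesis using caratheodory_solutionD(1)[OF car _ that(2), of "min r T" r] that by auto
  qed
  have "\<exists>t\<in>J. y t = c \<and> (\<forall>r<t. y r < c)" if c: "a < c" "c < B" for c
  proof -
    obtain Q where Q: "Q \<in> J" "y Q > c" using reach[OF c] by blast
    have "continuous_on {P..Q} y" for P
      using caratheodory_solutionD(4)[OF car dn[of P Q] Q(1)] Q(1) by (cases "P \<le> Q") auto
    from first_hitting_time[OF this lim c(1)] Q obtain t where "t \<le> Q" "y t = c" "\<And>r. r < t \<Longrightarrow> y r < c"
      by (metis less_imp_le)
    then show ?thesis using dn Q(1) by blast
  qed
  then obtain H where H: "\<And>c. a < c \<Longrightarrow> c < B \<Longrightarrow> H c \<in> J \<and> y (H c) = c \<and> (\<forall>r<H c. y r < c)" by metis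
  have Hmono: "H d \<le> H c" if "a < d" "d < c" "c < B" for c d
  proof (rule ccontr)
    assume "\<not> H d \<le> H c"
    moreover have "\<forall>r<H d. y r < d" using H[of d] that by auto
    ultimately have "y (H c) < d" by auto
    moreover have "y (H c) = c" using H[of c] that by auto
    ultimately show False using that by auto
  qed
  have cost: "V c - V d < integral {H d..H c} (\<lambda>t. \<bar>u t\<bar>)" if "a < d" "d < c" "c < B" for c d
  proof -
    have V': "(V has_real_derivative w x) (at x within {d..c})" if "x \<in> {d..c}" for x
      by (rule DERIV_subset[OF V]) (use that \<open>a < d\<close> \<open>c < B\<close> in auto)
    have w': "continuous_on {d..c} w" by (rule continuous_on_subset[OF w]) (use that in auto)
    have less': "w x * (f x + u t) < \<bar>u t\<bar>" if "x \<in> {d..c}" "t \<notin> N" for x t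
      using that \<open>a < d\<close> \<open>c < B\<close> by (intro less) auto
    have "H d \<in> J" "y (H d) \<le> d" "H c \<in> J" "c \<le> y (H c)" using H[of c] H[of d] that by auto
    from crossing_cost[OF car this(1,3) Hmono[OF that] this(2) that(2) this(4) uint V' w' N less']
    show ?thesis .
  qed
  \<comment> \<open>The fixed stretch that is overpaid by \<open>\<delta>\<close>.\<close>
  define d0 c0 where "d0 = a + (B - a) / 3" and "c0 = a + 2 * (B - a) / 3"
  have dc0: "a < d0" "d0 < c0" "c0 < B" using aB by (auto simp: d0_def c0_def field_simps)
  define \<delta> where "\<delta> = integral {H d0..H c0} (\<lambda>t. \<bar>u t\<bar>) - (V c0 - V d0)"
  have \<delta>: "\<delta> > 0" using cost[OF dc0] by (simp add: \<delta>_def)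
  have cV: "continuous_on {a..B} V" using V by (intro DERIV_continuous_on)
  obtain d where d: "a < d" "d < d0" "V d < \<delta> / 2"
  proof -
    have "a \<in> {a..B}" using aB by auto
    with cV \<delta> obtain e where e: "e > 0" "\<And>x. x \<in> {a..B} \<Longrightarrow> dist x a < e \<Longrightarrow> dist (V x) (V a) < \<delta> / 2"
      unfolding continuous_on_iff by (meson half_gt_zero)
    define d where "d = a + min e (d0 - a) / 2"
    have "a < d" "d < d0" "dist d a < e" using e dc0 by (auto simp: d_def dist_real_def min_def field_simps)
    then show thesis using e(2)[of d] dc0 that[of d] by (auto simp: V_def dist_real_def)
  qed
  obtain c where c: "c0 < c" "c < B" "V c > V B - \<delta> / 2"
  proof -
    have "B \<in> {a..B}" using aB by auto
    with cV \<delta> obtain e where e: "e > 0" "\<And>x. x \<in> {a..B} \<Longrightarrow> dist x B < e \<Longrightarrow> dist (V x) (V B) < \<delta> / 2"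
      unfolding continuous_on_iff by (meson half_gt_zero)
    define c where "c = B - min e (B - c0) / 2"
    have "c0 < c" "c < B" "dist c B < e" using e dc0 by (auto simp: c_def dist_real_def min_def field_simps)
    then show thesis using e(2)[of c] dc0 that[of c] by (auto simp: dist_real_def abs_if split: if_splits)
  qed
  have ui: "(\<lambda>t. \<bar>u t\<bar>) integrable_on {p..q}" for p q using uint[of p q] by (auto simp: absolutely_integrable_on_def)
  have "integral {H d..H d0} (\<lambda>t. \<bar>u t\<bar>) + integral {H d0..H c0} (\<lambda>t. \<bar>u t\<bar>) + integral {H c0..H c} (\<lambda>t. \<bar>u t\<bar>)
      = integral {H d..H c} (\<lambda>t. \<bar>u t\<bar>)"
    using Hmono[of d d0] Hmono[of d0 c0] Hmono[of c0 c] d c dc0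
    by (subst Henstock_Kurzweil_Integration.integral_combine; (subst Henstock_Kurzweil_Integration.integral_combine)?) (auto intro: ui)
  then have "integral {H d..H d0} (\<lambda>t. \<bar>u t\<bar>) + integral {H d0..H c0} (\<lambda>t. \<bar>u t\<bar>) + integral {H c0..H c} (\<lambda>t. \<bar>u t\<bar>) \<le> L"
    using L[of "H d" "H c"] by simp
  moreover have "V d0 - V d < integral {H d..H d0} (\<lambda>t. \<bar>u t\<bar>)" using d dc0 by (intro cost) auto
  moreover have "V c - V c0 < integral {H c0..H c} (\<lambda>t. \<bar>u t\<bar>)" using c dc0 by (intro cost) auto
  ultimately have "V B < L" using c(3) d(3) \<delta>_def by linarith
  then show False using Lw by (simp add: V_def)
qed

section \<open>Convergence and continuation of confined solutions\<close>

lemma integral_tail_small: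
  fixes v :: "real \<Rightarrow> real"
  assumes v: "(v has_integral L) UNIV" and v0: "\<And>t. 0 \<le> v t" and e: "e > 0"
  obtains T where "\<And>p q. T \<le> p \<Longrightarrow> integral {p..q} v < e"
proof -
  have vi: "v integrable_on {p..q}" for p q
    using v by (intro integrable_on_subinterval[of v UNIV]) (auto simp: integrable_on_def)
  have le: "integral {p..q} v \<le> L" for p q
    using integral_subset_le[of "{p..q}" UNIV v] v vi v0 by (auto simp: has_integral_iff)
  obtain B where B: "B > 0" "\<And>a b. ball 0 B \<subseteq> cbox a b \<Longrightarrow>
      (\<exists>z. ((\<lambda>x. if x \<in> UNIV then v x else 0) has_integral z) (cbox a b) \<and> norm (z - L) < e)"
    using has_integral'[THEN iffD1, OF v] e by blast
  have "ball 0 B \<subseteq> cbox (-B) B" by (auto simp: dist_real_def)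
  from B(2)[OF this] have *: "integral {-B..B} v > L - e"
    by (auto simp: has_integral_iff abs_less_iff)
  show thesis
  proof (rule that[of B])
    fix p q assume "B \<le> p"
    show "integral {p..q} v < e"
    proof (cases "p \<le> q")
      case True
      have "integral {-B..B} v + integral {B..q} v = integral {-B..q} v"
        by (rule Henstock_Kurzweil_Integration.integral_combine[OF _ _ vi]) (use B True \<open>B \<le> p\<close> in auto)
      moreover have "integral {p..q} v \<le> integral {B..q} v"
        by (rule integral_subset_le[OF _ vi vi]) (use \<open>B \<le> p\<close> v0 in auto)
      ultimately show ?thesis using * le[of "-B" q] by linarith
    qed (use e in auto)
  qed
qed

text \<open>Wait until the remaining variation is less than \<open>e / 2\<close>. As long as the solution stays above \<open>a + e / 2\<close>, the field pushes it
down at a speed bounded away from \<open>0\<close>; once below, climbing back to \<open>a + e\<close> would cost more than \<open>e / 2\<close>.\<close>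

lemma eventually_le_of_attraction:
  fixes f u y :: "real \<Rightarrow> real"
  assumes car: "caratheodory_solution f u UNIV y" and hi: "\<And>t. y t \<le> hi"
    and f: "continuous_on UNIV f" and neg: "\<And>x. a < x \<Longrightarrow> x \<le> hi \<Longrightarrow> f x < 0"
    and uint: "\<And>p q. u absolutely_integrable_on {p..q}"
    and L: "((\<lambda>t. \<bar>u t\<bar>) has_integral L) UNIV" and e: "e > 0"
  shows "\<forall>\<^sub>F t in at_top. y t \<le> a + e"
proof -
  have ui: "u integrable_on {p..q}" "(\<lambda>t. \<bar>u t\<bar>) integrable_on {p..q}" for p q
    using uint[of p q] by (auto simp: absolutely_integrable_on_def)
  obtain T where T: "\<And>p q. T \<le> p \<Longrightarrow> integral {p..q} (\<lambda>t. \<bar>u t\<bar>) < e / 2"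
    using integral_tail_small[OF L _ half_gt_zero[OF e]] by auto
  have "\<exists>t0\<ge>T. y t0 \<le> a + e / 2"
  proof (rule ccontr)
    assume "\<not> ?thesis"
    then have gt: "y t > a + e / 2" if "t \<ge> T" for t using that by force
    have ne: "{a + e / 2..hi} \<noteq> {}" using gt[of T] hi[of T] by auto
    obtain x0 where x0: "x0 \<in> {a + e / 2..hi}" "\<And>x. x \<in> {a + e / 2..hi} \<Longrightarrow> f x \<le> f x0"
      using continuous_attains_sup[OF compact_Icc ne continuous_on_subset[OF f]] by auto
    define \<kappa> where "\<kappa> = - f x0"
    have \<kappa>: "\<kappa> > 0" using neg[of x0] x0(1) e by (auto simp: \<kappa>_def)
    \<comment> \<open>By this time a descent at speed \<open>\<kappa>\<close> has passed below \<open>a\<close>.\<close>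
    define t where "t = T + (\<bar>y T\<bar> + \<bar>a\<bar> + e) / \<kappa>"
    have tT: "T \<le> t" using \<kappa> e by (simp add: t_def)
    have fy: "f (y r) \<le> - \<kappa>" if "r \<in> {T..t}" for r
      using x0(2)[of "y r"] gt[of r] hi[of r] that by (simp add: \<kappa>_def)
    have "integral {T..t} (\<lambda>r. f (y r) + u r) \<le> integral {T..t} (\<lambda>r. - \<kappa> + \<bar>u r\<bar>)"
    proof (rule integral_le)
      show "(\<lambda>r. f (y r) + u r) integrable_on {T..t}"
        using caratheodory_solutionD(2)[OF car, of T t] tT by (simp add: absolutely_integrable_on_def)
      show "(\<lambda>r. - \<kappa> + \<bar>u r\<bar>) integrable_on {T..t}" by (intro integrable_add ui) auto
      fix r assume "r \<in> {T..t}"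
      from fy[OF this] show "f (y r) + u r \<le> - \<kappa> + \<bar>u r\<bar>" by linarith
    qed
    also have "\<dots> = - \<kappa> * (t - T) + integral {T..t} (\<lambda>r. \<bar>u r\<bar>)"
      using tT by (subst integral_add) (auto intro: ui)
    also have "\<dots> < - \<kappa> * (t - T) + e / 2" using T[of T t] by simp
    finally have "y t < y T - \<kappa> * (t - T) + e / 2"
      using caratheodory_solutionD(3)[OF car, of T t] tT by simp
    also have "\<kappa> * (t - T) = \<bar>y T\<bar> + \<bar>a\<bar> + e" using \<kappa> by (simp add: t_def)
    finally show False using gt[OF tT] e by linarith
  qed
  then obtain t0 where t0: "t0 \<ge> T" "y t0 \<le> a + e / 2" by blast
  have "y t \<le> a + e" if "t \<ge> t0" for t
  proof (rule ccontr)
    assume n: "\<not> y t \<le> a + e"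
    have "(a + e) - (a + e / 2) < integral {t0..t} (\<lambda>t. \<bar>u t\<bar>)"
    proof (rule crossing_cost[OF car _ _ that t0(2) _ _ uint, where V="\<lambda>x. x" and w="\<lambda>_. 1" and N="{}"])
      fix x r assume "x \<in> {a + e / 2..a + e}"
      then have "f x < 0" using neg[of x] hi[of t] n e by auto
      then show "1 * (f x + u r) < \<bar>u r\<bar>" by auto
    qed (use n e in auto)
    then show False using T[of t0 t] t0 by simp
  qed
  then show ?thesis unfolding eventually_at_top_linorder by blast
qed

lemma absolutely_integrable_neg:
  fixes g :: "real \<Rightarrow> real"
  assumes "g absolutely_integrable_on S"
  shows "(\<lambda>x. - g x) absolutely_integrable_on S"
  using assms integrable_neg[of g S] by (simp add: absolutely_integrable_on_def)

lemma caratheodory_solution_reflect: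
  assumes "caratheodory_solution f u J y"
  shows "caratheodory_solution (\<lambda>x. - f (- x)) (\<lambda>t. - u t) J (\<lambda>t. - y t)"
proof -
  have eq: "(\<lambda>s. - f (- (- y s)) + - u s) = (\<lambda>s. - (f (y s) + u s))" by auto
  show ?thesis
    unfolding caratheodory_solution_def eq
  proof (intro conjI ballI impI)
    show "is_interval J" using assms by (simp add: caratheodory_solution_def)
    fix s t assume st: "s \<in> J" "t \<in> J" "s \<le> t"
    show "(\<lambda>s. - (f (y s) + u s)) absolutely_integrable_on {s..t}"
      by (rule absolutely_integrable_neg[OF caratheodory_solutionD(2)[OF assms st]])
    show "- y t = - y s + integral {s..t} (\<lambda>s. - (f (y s) + u s))"
      using caratheodory_solutionD(3)[OF assms st] unfolding integral_neg by linarith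
  qed
qed

text \<open>Picard's contraction, on the bounded continuous functions on the whole line: space is clipped to \<open>{lo..hi}\<close> and time to \<open>{b..b + h}\<close>,
so that the integral operator is globally defined. The clipping in space is inactive near \<open>b\<close>.\<close>

lemma local_caratheodory_solution:
  fixes f u :: "real \<Rightarrow> real"
  assumes K: "K-lipschitz_on {lo..hi} f" and z: "lo < z" "z < hi"
    and u: "\<And>p q. u absolutely_integrable_on {p..q}"
  shows "\<exists>h>0. \<exists>w. w b = z \<and> (\<forall>t. b \<le> t \<longrightarrow> t \<le> b + h \<longrightarrow>
    (\<lambda>s. f (w s) + u s) absolutely_integrable_on {b..t} \<and>
    w t = z + integral {b..t} (\<lambda>s. f (w s) + u s))"
proof -
  have K0: "K \<ge> 0" using K by (rule lipschitz_on_nonneg)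
  define clip where "clip x = max lo (min hi x)" for x
  have clip: "clip x \<in> {lo..hi}" for x using z by (auto simp: clip_def)
  have clip_id: "clip x = x" if "x \<in> {lo..hi}" for x using that by (auto simp: clip_def)
  define F where "F x = f (clip x)" for x
  have Flip: "\<bar>F x - F x'\<bar> \<le> K * \<bar>x - x'\<bar>" for x x'
  proof -
    have "\<bar>F x - F x'\<bar> \<le> K * \<bar>clip x - clip x'\<bar>"
      using lipschitz_onD[OF K clip clip, of x x'] by (simp add: dist_real_def F_def)
    also have "\<dots> \<le> K * \<bar>x - x'\<bar>" by (intro mult_left_mono K0) (auto simp: clip_def)
    finally show ?thesis .
  qed
  have Fcont: "continuous_on UNIV F"
    by (rule lipschitz_on_continuous_on[of K]) (auto intro!: lipschitz_onI K0 Flip simp: dist_real_def)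
  \<comment> \<open>Any step with \<open>K * h < 1\<close> gives a contraction; \<open>K + 1\<close> avoids division by \<open>0\<close>.\<close>
  define h where "h = 1 / (2 * (K + 1))"
  have h: "h > 0" "K * h \<le> 1 / 2" using K0 by (auto simp: h_def divide_simps)
  define \<tau> where "\<tau> t = max b (min (b + h) t)" for t
  have \<tau>: "\<tau> t \<in> {b..b+h}" for t using h by (auto simp: \<tau>_def)
  have \<tau>cont: "continuous_on UNIV \<tau>" unfolding \<tau>_def by (intro continuous_intros)
  have gai: "(\<lambda>s. F (w s) + u s) absolutely_integrable_on {p..q}" if "continuous_on UNIV w" for w p q
  proof -
    have "continuous_on {p..q} (\<lambda>s. F (w s))"
      by (rule continuous_on_compose2[OF Fcont continuous_on_subset[OF that]]) auto
    then have "(\<lambda>s. F (w s)) absolutely_integrable_on {p..q}" by (rule absolutely_integrable_continuous_real)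
    then show ?thesis using u by (rule set_integral_add)
  qed
  have gi: "(\<lambda>s. F (w s) + u s) integrable_on {p..q}" if "continuous_on UNIV w" for w p q
    using gai[OF that] by (simp add: absolutely_integrable_on_def)
  define \<Phi>0 where "\<Phi>0 w t = z + integral {b..\<tau> t} (\<lambda>s. F (w s) + u s)" for w t
  have \<Phi>0: "\<Phi>0 w \<in> bcontfun" if "continuous_on UNIV w" for w
  proof -
    define I where "I t = z + integral {b..t} (\<lambda>s. F (w s) + u s)" for t
    have I: "continuous_on {b..b+h} I" unfolding I_def
      by (intro continuous_intros indefinite_integral_continuous_1 gi that)
    have eq: "\<Phi>0 w = (\<lambda>t. I (\<tau> t))" by (auto simp: \<Phi>0_def I_def)
    have "continuous_on UNIV (\<Phi>0 w)" unfolding eq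
      by (rule continuous_on_compose2[OF I \<tau>cont]) (use \<tau> in auto)
    moreover have "bounded (range (\<Phi>0 w))"
    proof (rule bounded_subset)
      show "bounded (I ` {b..b+h})" by (intro compact_imp_bounded compact_continuous_image I) auto
      show "range (\<Phi>0 w) \<subseteq> I ` {b..b+h}" unfolding eq using \<tau> by auto
    qed
    ultimately show ?thesis by (simp add: bcontfun_def)
  qed
  define \<Phi> where "\<Phi> w = Bcontfun (\<Phi>0 (apply_bcontfun w))" for w :: "real \<Rightarrow>\<^sub>C real"
  have wc: "continuous_on UNIV (apply_bcontfun w)" for w :: "real \<Rightarrow>\<^sub>C real"
    using apply_bcontfun[of w] by (simp add: bcontfun_def)
  have \<Phi>: "apply_bcontfun (\<Phi> w) t = z + integral {b..\<tau> t} (\<lambda>s. F (apply_bcontfun w s) + u s)" for w t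
    unfolding \<Phi>_def by (subst Bcontfun_inverse[OF \<Phi>0[OF wc]]) (simp add: \<Phi>0_def)
  have "\<exists>!w. \<Phi> w = w"
  proof (rule banach_fix_type[of "1/2"])
    show "\<forall>v w. dist (\<Phi> v) (\<Phi> w) \<le> 1 / 2 * dist v w"
    proof (intro allI dist_bound)
      fix v w :: "real \<Rightarrow>\<^sub>C real" and t
      have "dist (apply_bcontfun (\<Phi> v) t) (apply_bcontfun (\<Phi> w) t)
        = norm (integral {b..\<tau> t} (\<lambda>s. (F (apply_bcontfun v s) + u s) - (F (apply_bcontfun w s) + u s)))"
        by (subst integral_diff) (auto simp: dist_real_def \<Phi> intro!: gi wc)
      also have "\<dots> \<le> integral {b..\<tau> t} (\<lambda>s. K * dist v w)"
      proof (rule integral_norm_bound_integral)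
        fix s
        have "\<bar>F (apply_bcontfun v s) - F (apply_bcontfun w s)\<bar> \<le> K * \<bar>apply_bcontfun v s - apply_bcontfun w s\<bar>" by (rule Flip)
        also have "\<dots> \<le> K * dist v w"
          using dist_bounded[of v s w] by (intro mult_left_mono K0) (simp add: dist_real_def)
        finally show "norm ((F (apply_bcontfun v s) + u s) - (F (apply_bcontfun w s) + u s)) \<le> K * dist v w" by simp
      qed (intro integrable_diff gi wc integrable_const_ivl)+
      also have "\<dots> = (\<tau> t - b) * (K * dist v w)" using \<tau>[of t] by simp
      also have "\<dots> \<le> h * (K * dist v w)" using \<tau>[of t] K0 by (intro mult_right_mono) auto
      also have "\<dots> = (K * h) * dist v w" by simp
      also have "\<dots> \<le> 1 / 2 * dist v w" by (intro mult_right_mono h) auto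
      finally show "dist (apply_bcontfun (\<Phi> v) t) (apply_bcontfun (\<Phi> w) t) \<le> 1 / 2 * dist v w" .
    qed
  qed auto
  then obtain W where W: "\<Phi> W = W" by blast
  define w where "w = apply_bcontfun W"
  have wcont: "continuous_on UNIV w" unfolding w_def by (rule wc)
  have weq: "w t = z + integral {b..t} (\<lambda>s. F (w s) + u s)" if "b \<le> t" "t \<le> b + h" for t
  proof -
    have "\<tau> t = t" using that by (simp add: \<tau>_def)
    then show ?thesis using \<Phi>[of W t] W by (simp add: w_def)
  qed
  have wb: "w b = z" using weq[of b] h by simp
  have "isCont w b" using wcont by (simp add: continuous_on_eq_continuous_at)
  then have "\<forall>\<^sub>F t in at b. w t \<in> {lo<..<hi}"
    using z wb by (intro topological_tendstoD[where f=w and l="w b"]) (auto simp: isCont_def)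
  then obtain d where d: "d > 0" "\<And>t. t \<noteq> b \<Longrightarrow> dist t b < d \<Longrightarrow> w t \<in> {lo<..<hi}"
    by (auto simp: eventually_at)
  define k where "k = min h (d / 2)"
  have k: "k > 0" "k \<le> h" "k < d" using d h by (auto simp: k_def)
  have win: "w t \<in> {lo..hi}" if "b \<le> t" "t \<le> b + k" for t
  proof (cases "t = b")
    case False
    then show ?thesis using d(2)[of t] that k by (force simp: dist_real_def)
  qed (use wb z in auto)
  have eqF: "F (w s) + u s = f (w s) + u s" if "b \<le> t" "t \<le> b + k" "s \<in> {b..t}" for s t
    using win[of s] that by (simp add: F_def clip_id)
  have "(\<lambda>s. f (w s) + u s) absolutely_integrable_on {b..t} \<and>
    w t = z + integral {b..t} (\<lambda>s. f (w s) + u s)" if t: "b \<le> t" "t \<le> b + k" for t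
  proof
    show "(\<lambda>s. f (w s) + u s) absolutely_integrable_on {b..t}"
      by (rule absolutely_integrable_spike[OF gai[OF wcont] negligible_empty]) (use eqF[OF t] in auto)
    have "integral {b..t} (\<lambda>s. F (w s) + u s) = integral {b..t} (\<lambda>s. f (w s) + u s)"
      by (rule integral_cong) (rule eqF[OF t])
    then show "w t = z + integral {b..t} (\<lambda>s. f (w s) + u s)" using weq[of t] t k by linarith
  qed
  then show ?thesis using k(1) wb by blast
qed

lemma absolutely_integrable_combine_real:
  fixes g :: "real \<Rightarrow> real"
  assumes "a \<le> c" "c \<le> b" "g absolutely_integrable_on {a..c}" "g absolutely_integrable_on {c..b}"
  shows "g absolutely_integrable_on {a..b}"
  using assms unfolding absolutely_integrable_on_def
  by (auto intro: Henstock_Kurzweil_Integration.integrable_combine)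

text \<open>Otherwise \<open>J\<close> ends at some \<open>b\<close>. The right-hand side is integrable up to \<open>b\<close>, which defines the value \<open>z\<close> at \<open>b\<close> whether or not \<open>b\<close>
belongs to \<open>J\<close>; continuing from there with a local solution contradicts maximality.\<close>

lemma bounded_maximal_solution_is_global:
  fixes f u y :: "real \<Rightarrow> real"
  assumes max: "maximal_solution f u J y" and J: "{..T} \<subseteq> J"
    and bd: "\<And>t. t \<in> J \<Longrightarrow> y t \<in> {lo..hi}"
    and f: "\<And>R. \<exists>K. K-lipschitz_on {-R..R} f"
    and u: "\<And>p q. u absolutely_integrable_on {p..q}"
  shows "J = UNIV"
proof (rule ccontr)
  assume "J \<noteq> UNIV"
  then obtain s0 where s0: "s0 \<notin> J" by blast
  have car: "caratheodory_solution f u J y" using max by (simp add: maximal_solution_def)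
  have dn: "r \<in> J" if "r \<le> t" "t \<in> J" for r t
  proof -
    have "min r T \<in> J" using J by auto
    then show ?thesis using caratheodory_solutionD(1)[OF car _ that(2), of "min r T" r] that by auto
  qed
  have TJ: "T \<in> J" using J by auto
  have bdd: "bdd_above J" using dn s0 by (intro bdd_aboveI[of _ s0]) (meson linear)
  define b where "b = Sup J"
  have Jb: "t \<le> b" if "t \<in> J" for t unfolding b_def using bdd that by (rule cSup_upper[rotated])
  have bJ: "t \<in> J" if "t < b" for t
  proof -
    have "J \<noteq> {}" using TJ by auto
    then have "\<exists>t'\<in>J. t < t'" using that less_cSup_iff[OF _ bdd, of t] unfolding b_def by simp
    then show ?thesis using dn by (meson less_imp_le)
  qed
  have fcont: "continuous_on {lo..hi} f"
  proof -
    define R where "R = max \<bar>lo\<bar> \<bar>hi\<bar>"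
    obtain K where "K-lipschitz_on {-R..R} f" using f by blast
    then have "continuous_on {-R..R} f" by (rule lipschitz_on_continuous_on)
    then show ?thesis by (rule continuous_on_subset) (auto simp: R_def)
  qed
  define g where "g r = f (y r) + u r" for r
  have gai: "g absolutely_integrable_on {s..b}" if "s < b" for s
  proof -
    have cy: "continuous_on {s..<b} y"
      unfolding continuous_on_eq_continuous_within
    proof
      fix r assume r: "r \<in> {s..<b}"
      define r' where "r' = (r + b) / 2"
      have r': "r < r'" "r' < b" using r by (auto simp: r'_def)
      have "continuous_on {s..r'} y" using bJ r r' by (intro caratheodory_solutionD(4)[OF car]) auto
      then have "continuous (at r within {s..r'}) y" using r r' by (auto simp: continuous_on_eq_continuous_within)
      moreover have "at r within {s..<b} = at r within {s..r'}"
        by (rule at_within_nhd[of _ "{..<r'}"]) (use r r' in auto)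
      ultimately show "continuous (at r within {s..<b}) y" by simp
    qed
    have "continuous_on {s..<b} (\<lambda>r. f (y r))"
      by (rule continuous_on_compose2[OF fcont cy]) (use bd bJ in auto)
    then have m: "(\<lambda>r. f (y r)) \<in> borel_measurable (lebesgue_on {s..<b})"
      by (rule continuous_imp_measurable_on_sets_lebesgue) auto
    have "bounded (f ` {lo..hi})" by (intro compact_imp_bounded compact_continuous_image fcont) auto
    then have bf: "bounded ((\<lambda>r. f (y r)) ` {s..<b})"
      by (rule bounded_subset) (use bd bJ in auto)
    have "(\<lambda>r. 1 :: real) absolutely_integrable_on {s..b}" by (rule absolutely_integrable_continuous_real) auto
    then have one: "(\<lambda>r. 1 :: real) absolutely_integrable_on {s..<b}" by (rule set_integrable_subset) auto
    have "(\<lambda>r. f (y r) * 1) absolutely_integrable_on {s..<b}"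
      by (rule absolutely_integrable_bounded_measurable_product_real[OF m _ bf one]) simp
    then have "(\<lambda>r. f (y r)) absolutely_integrable_on {s..<b}" by simp
    then have "(\<lambda>r. f (y r)) absolutely_integrable_on {s..b}"
    proof (rule absolutely_integrable_spike_set)
      show "negligible {x \<in> {s..<b} - {s..b}. f (y x) \<noteq> 0}" by (rule negligible_subset[of "{}"]) auto
      show "negligible {x \<in> {s..b} - {s..<b}. f (y x) \<noteq> 0}" by (rule negligible_subset[of "{b}"]) auto
    qed
    then show ?thesis unfolding g_def using u by (rule set_integral_add)
  qed
  then have gi: "g integrable_on {s..b}" if "s < b" for s using that by (simp add: absolutely_integrable_on_def)
  have inc: "y t = y s + integral {s..t} g" if "s \<le> t" "t \<in> J" for s t
    using caratheodory_solutionD(3)[OF car dn[OF that] that(2,1)] unfolding g_def .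
  define z where "z = y (b - 1) + integral {b-1..b} g"
  \<comment> \<open>The prospective value at \<open>b\<close> is the same from every starting time.\<close>
  have zeq: "z = y s + integral {s..b} g" if "s < b" for s
  proof -
    have *: "y s + integral {s..b} g = y s' + integral {s'..b} g" if "s \<le> s'" "s' < b" for s s'
    proof -
      have "integral {s..s'} g + integral {s'..b} g = integral {s..b} g"
        by (rule Henstock_Kurzweil_Integration.integral_combine[OF _ _ gi]) (use that in auto)
      then show ?thesis using inc[OF that(1) bJ[OF that(2)]] by simp
    qed
    show ?thesis
    proof (cases "s \<le> b - 1")
      case True
      have "b - 1 < b" by simp
      from *[OF True this] show ?thesis unfolding z_def by linarith
    next
      case False
      then have "b - 1 \<le> s" by simp
      from *[OF this that] show ?thesis unfolding z_def by linarith
    qed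
  qed
  obtain K where K: "K-lipschitz_on {-(\<bar>z\<bar>+1)..\<bar>z\<bar>+1} f" using f by blast
  have zb: "- (\<bar>z\<bar> + 1) < z" "z < \<bar>z\<bar> + 1" by auto
  obtain h w where h: "h > 0" and w: "w b = z" and sol: "\<forall>t. b \<le> t \<longrightarrow> t \<le> b + h \<longrightarrow>
    (\<lambda>s. f (w s) + u s) absolutely_integrable_on {b..t} \<and>
    w t = z + integral {b..t} (\<lambda>s. f (w s) + u s)"
    using local_caratheodory_solution[OF K zb u, of b] by (elim exE conjE)
  have wai: "(\<lambda>s. f (w s) + u s) absolutely_integrable_on {b..t}"
    and weq: "w t = z + integral {b..t} (\<lambda>s. f (w s) + u s)" if "b \<le> t" "t \<le> b + h" for t
    using sol[rule_format, OF that] by (rule conjunct1, rule conjunct2)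
  define y' where "y' t = (if t < b then y t else w t)" for t
  define g' where "g' r = f (y' r) + u r" for r
  have left: "g' absolutely_integrable_on {s..t} \<and> y' t = y' s + integral {s..t} g'" if "s \<le> t" "t \<le> b" for s t
  proof (cases "t < b")
    case True
    have ga: "g absolutely_integrable_on {s..t}"
      using caratheodory_solutionD(2)[OF car dn[OF that(1) bJ[OF True]] bJ[OF True] that(1)]
      unfolding g_def[abs_def] .
    have gg: "g' r = g r" if "r \<in> {s..t}" for r
      using True that by (simp add: g'_def g_def y'_def)
    have "g' absolutely_integrable_on {s..t}"
      by (rule absolutely_integrable_spike[OF ga negligible_empty]) (simp add: gg)
    moreover have "integral {s..t} g' = integral {s..t} g"
      by (rule integral_cong) (rule gg)
    moreover have "y' t = y t" "y' s = y s" using True that by (simp_all add: y'_def)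
    ultimately show ?thesis using inc[OF that(1) bJ[OF True]] by linarith
  next
    case False
    then have tb: "t = b" using that by simp
    show ?thesis
    proof (cases "s = b")
      case True
      then show ?thesis using tb absolutely_integrable_negligible[OF negligible_sing[of b], where f=g'] by simp
    next
      case False
      then have sb: "s < b" using that tb by simp
      have gg: "g' r = g r" if "r \<in> {s..b} - {b}" for r
        using that by (simp add: g'_def g_def y'_def)
      have "g' absolutely_integrable_on {s..b}"
        by (rule absolutely_integrable_spike[OF gai[OF sb] negligible_sing gg])
      moreover have "integral {s..b} g = integral {s..b} g'"
        by (rule integral_spike[OF negligible_sing gg])
      moreover have "y' b = z" "y' s = y s" using w sb by (simp_all add: y'_def)
      ultimately show ?thesis using zeq[OF sb] unfolding tb by linarith
    qed
  qed
  have right0: "g' absolutely_integrable_on {b..t} \<and> y' t = y' b + integral {b..t} g'" if "b \<le> t" "t \<le> b + h" for t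
  proof -
    have gg: "g' r = f (w r) + u r" if "r \<in> {b..t}" for r
      using that by (simp add: g'_def y'_def)
    have "g' absolutely_integrable_on {b..t}"
      by (rule absolutely_integrable_spike[OF wai[OF that] negligible_empty]) (simp add: gg)
    moreover have "integral {b..t} g' = integral {b..t} (\<lambda>s. f (w s) + u s)"
      by (rule integral_cong) (rule gg)
    moreover have "y' b = z" "y' t = w t" using w that by (simp_all add: y'_def)
    ultimately show ?thesis using weq[OF that] by linarith
  qed
  have right: "g' absolutely_integrable_on {s..t} \<and> y' t = y' s + integral {s..t} g'" if "b \<le> s" "s \<le> t" "t \<le> b + h" for s t
  proof -
    have "b \<le> t" "s \<le> b + h" using that by auto
    note t = right0[OF this(1) that(3)] and s = right0[OF that(1) this(2)]
    have bt: "g' absolutely_integrable_on {b..t}" and e1: "y' t = y' b + integral {b..t} g'"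
      using t by (rule conjunct1, rule conjunct2)
    have e2: "y' s = y' b + integral {b..s} g'" using s by (rule conjunct2)
    have "integral {b..s} g' + integral {s..t} g' = integral {b..t} g'"
      by (rule Henstock_Kurzweil_Integration.integral_combine) (use bt that in \<open>auto simp: absolutely_integrable_on_def\<close>)
    moreover have "g' absolutely_integrable_on {s..t}"
      by (rule absolutely_integrable_on_subinterval[OF bt]) (use that in auto)
    ultimately show ?thesis using e1 e2 by linarith
  qed
  have "caratheodory_solution f u {..b+h} y'"
    unfolding caratheodory_solution_def
  proof (intro conjI ballI impI)
    show "is_interval {..b+h}" by (simp add: is_interval_ic)
    fix s t assume st: "s \<in> {..b+h}" "t \<in> {..b+h}" "s \<le> t"
    have "g' absolutely_integrable_on {s..t} \<and> y' t = y' s + integral {s..t} g'"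
    proof -
      consider "t \<le> b" | "b \<le> s" | "s < b" "b < t" by linarith
      then show ?thesis
      proof cases
        case 1 show ?thesis by (rule left[OF st(3) 1])
      next
        case 2 show ?thesis by (rule right[OF 2 st(3)]) (use st in simp)
      next
        case 3
        have "s \<le> b" "b \<le> b" "b \<le> t" "t \<le> b + h" using 3 st by auto
        note lr = left[OF this(1,2)] right0[OF this(3,4)]
        have l: "g' absolutely_integrable_on {s..b}" "y' b = y' s + integral {s..b} g'"
          using lr(1) by (rule conjunct1, rule conjunct2)
        have r: "g' absolutely_integrable_on {b..t}" "y' t = y' b + integral {b..t} g'"
          using lr(2) by (rule conjunct1, rule conjunct2)
        have "g' absolutely_integrable_on {s..t}"
          by (rule absolutely_integrable_combine_real[OF _ _ l(1) r(1)]) (use 3 in auto)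
        moreover from this have "integral {s..b} g' + integral {b..t} g' = integral {s..t} g'"
          by (intro Henstock_Kurzweil_Integration.integral_combine) (use 3 in \<open>auto simp: absolutely_integrable_on_def\<close>)
        ultimately show ?thesis using l(2) r(2) by linarith
      qed
    qed
    then show "(\<lambda>s. f (y' s) + u s) absolutely_integrable_on {s..t}"
      and "y' t = y' s + integral {s..t} (\<lambda>s. f (y' s) + u s)"
      unfolding g'_def[abs_def] by (rule conjunct1, rule conjunct2)
  qed
  moreover have "J \<subseteq> {..b+h}" using Jb h by force
  moreover have "\<forall>t\<in>J. y' t = y t"
  proof
    fix t assume t: "t \<in> J"
    show "y' t = y t"
    proof (cases "t < b")
      case False
      then have "t = b" using Jb[OF t] by simp
      then have "y t = z" "y' t = w b" using inc[of "b - 1" b] t by (auto simp: y'_def z_def)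
      then show ?thesis using w by simp
    qed (simp add: y'_def)
  qed
  ultimately have "{..b+h} = J" using max unfolding maximal_solution_def by blast
  then show False using Jb[of "b + h"] h by auto
qed

section \<open>Reciprocal prices and the critical rate\<close>

text \<open>The shape of a reciprocal price: it is \<open>0\<close> up to the threshold \<open>M\<close>, where the price is infinite, grows strictly afterwards, and tends to the reciprocal
distance \<open>c\<close> as the rate grows.\<close>

definition budget_profile :: "(real \<Rightarrow> real) \<Rightarrow> ereal \<Rightarrow> real \<Rightarrow> bool" where
  "budget_profile k M c \<longleftrightarrow> continuous_on UNIV k \<and> (\<forall>m. 0 \<le> k m) \<and> (\<forall>m. ereal m \<le> M \<longrightarrow> k m = 0) \<and>
     (\<forall>m m'. M \<le> ereal m \<and> m < m' \<longrightarrow> k m < k m') \<and> (k \<longlongrightarrow> c) at_top"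

text \<open>Below the threshold of one side that side contributes \<open>0\<close>, so strict growth of the other side
is strict growth of the maximum.\<close>

lemma budget_profile_max:
  assumes "budget_profile k1 M1 c1" "budget_profile k2 M2 c2"
  shows "budget_profile (\<lambda>m. max (k1 m) (k2 m)) (min M1 M2) (max c1 c2)"
proof -
  have mono: "max (k1 m) (k2 m) < max (k1 m') (k2 m')" if M: "min M1 M2 \<le> ereal m" and m: "m < m'" for m m'
  proof -
    have 1: "M1 \<le> ereal m \<Longrightarrow> k1 m < k1 m'" "ereal m \<le> M1 \<Longrightarrow> k1 m = 0" "0 \<le> k1 m" "0 \<le> k1 m'"
      using assms(1) m by (auto simp: budget_profile_def)
    have 2: "M2 \<le> ereal m \<Longrightarrow> k2 m < k2 m'" "ereal m \<le> M2 \<Longrightarrow> k2 m = 0" "0 \<le> k2 m" "0 \<le> k2 m'"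
      using assms(2) m by (auto simp: budget_profile_def)
    consider "M1 \<le> ereal m" "M2 \<le> ereal m" | "M1 \<le> ereal m" "ereal m \<le> M2" | "ereal m \<le> M1" "M2 \<le> ereal m"
      using M by (metis linear min_le_iff_disj)
    then show ?thesis using 1 2 by cases auto
  qed
  show ?thesis
    unfolding budget_profile_def
  proof (intro conjI allI impI)
    show "continuous_on UNIV (\<lambda>m. max (k1 m) (k2 m))"
      using assms by (intro continuous_on_max) (auto simp: budget_profile_def)
    show "((\<lambda>m. max (k1 m) (k2 m)) \<longlongrightarrow> max c1 c2) at_top"
      using assms by (intro tendsto_max) (auto simp: budget_profile_def)
    show "max (k1 m) (k2 m) < max (k1 m') (k2 m')" if "min M1 M2 \<le> ereal m \<and> m < m'" for m m'
      using mono that by blast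
  qed (use assms in \<open>auto simp: budget_profile_def le_max_iff_disj\<close>)
qed

lemma budget_profile_zero: "budget_profile (\<lambda>_. 0) \<infinity> 0"
  by (auto simp: budget_profile_def)

lemma budget_profile_inverse:
  assumes k: "budget_profile k (ereal \<mu>) (1 / R)" and R: "R > 0"
  obtains mc where "\<And>L. L > R \<Longrightarrow> \<mu> < mc L" "\<And>L. L > R \<Longrightarrow> k (mc L) = 1 / L"
    "continuous_on {R<..} mc" "strict_antimono_on {R<..} mc"
    "filterlim mc at_top (at_right R)" "(mc \<longlongrightarrow> \<mu>) at_top"
proof -
  have cont: "continuous_on UNIV k" and k0: "k \<mu> = 0"
    and mono: "\<And>m m'. \<mu> \<le> m \<Longrightarrow> m < m' \<Longrightarrow> k m < k m'" and lim: "(k \<longlongrightarrow> 1 / R) at_top"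
    using k by (auto simp: budget_profile_def)
  have less_iff: "k m < k m' \<longleftrightarrow> m < m'" if "\<mu> \<le> m" "\<mu> \<le> m'" for m m'
    using mono[of m m'] mono[of m' m] that by (metis less_irrefl less_trans linorder_neqE)
  have kR: "k m < 1 / R" if "\<mu> \<le> m" for m
  proof -
    have "k m < k (m + 1)" using mono[of m "m + 1"] that by simp
    also have "k (m + 1) \<le> 1 / R"
    proof (rule tendsto_lowerbound[OF lim])
      show "\<forall>\<^sub>F x in at_top. k (m + 1) \<le> k x"
        using eventually_gt_at_top[of "m + 1"]
        by eventually_elim (use mono[of "m + 1"] that less_imp_le in auto)
    qed simp
    finally show ?thesis .
  qed
  have "\<exists>m>\<mu>. k m = 1 / L" if L: "L > R" for L
  proof -
    have L0: "0 < 1 / L" "1 / L < 1 / R" using L R by (auto simp: frac_less2)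
    have "\<forall>\<^sub>F m in at_top. 1 / L < k m" using lim L0(2) by (rule order_tendstoD)
    then have "\<forall>\<^sub>F m in at_top. 1 / L < k m \<and> m > \<mu>"
      using eventually_gt_at_top[of \<mu>] by eventually_elim auto
    then obtain m1 where m1: "1 / L < k m1" "m1 > \<mu>" 
      using eventually_happens'[OF trivial_limit_at_top_linorder] by blast
    have "\<exists>m\<ge>\<mu>. m \<le> m1 \<and> k m = 1 / L"
      by (rule IVT') (use m1 k0 L0 in \<open>auto intro: continuous_on_subset[OF cont]\<close>)
    then obtain m where m: "\<mu> \<le> m" "k m = 1 / L" by blast
    then have "m \<noteq> \<mu>" using k0 L0 by auto
    then show ?thesis using m by (intro exI[of _ m]) auto
  qed
  then obtain mc where mc: "\<And>L. L > R \<Longrightarrow> \<mu> < mc L \<and> k (mc L) = 1 / L" by metis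
  have anti: "mc L' < mc L" if "R < L" "L < L'" for L L'
  proof -
    have "1 / L' < 1 / L" using that R by (auto simp: frac_less2)
    then show ?thesis using mc[of L] mc[of L'] less_iff[of "mc L'" "mc L"] that by auto
  qed
  show thesis
  proof (rule that[of mc])
    show "strict_antimono_on {R<..} mc" by (rule monotone_onI) (use anti in auto)
    \<comment> \<open>A monotone function with open image is continuous.\<close>
    have im: "(\<lambda>L. - mc L) ` {R<..} = {..<- \<mu>}"
    proof (intro set_eqI iffI)
      fix z assume z: "z \<in> {..<- \<mu>}"
      define m where "m = - z"
      have m: "m > \<mu>" using z by (simp add: m_def)
      have km: "0 < k m" "k m < 1 / R" using mono[of \<mu> m] k0 kR[of m] m by auto
      then have L: "1 / k m > R" using R by (simp add: field_simps)
      have "k (mc (1 / k m)) = k m" using mc[OF L] by simp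
      then have "mc (1 / k m) = m" using less_iff[of m "mc (1 / k m)"] less_iff[of "mc (1 / k m)" m] mc[OF L] m
        by (cases "mc (1 / k m)" m rule: linorder_cases) auto
      then show "z \<in> (\<lambda>L. - mc L) ` {R<..}" using L by (intro image_eqI[of _ _ "1 / k m"]) (auto simp: m_def)
    qed (use mc in auto)
    have "continuous_on {R<..} (\<lambda>L. - mc L)"
    proof (rule continuous_onI_mono)
      show "open ((\<lambda>L. - mc L) ` {R<..})" unfolding im by simp
      show "- mc L \<le> - mc L'" if "L \<in> {R<..}" "L' \<in> {R<..}" "L \<le> L'" for L L'
        using anti[of L L'] that by (cases "L = L'") auto
    qed
    then show "continuous_on {R<..} mc" using continuous_on_minus by fastforce
    show "filterlim mc at_top (at_right R)"
      unfolding filterlim_at_top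
    proof
      fix Z :: real
      define Z' where "Z' = max Z (\<mu> + 1)"
      have kZ: "0 < k Z'" "k Z' < 1 / R" using mono[of \<mu> Z'] k0 kR[of Z'] by (auto simp: Z'_def)
      then have b: "R < 1 / k Z'" using R by (simp add: field_simps)
      show "\<forall>\<^sub>F L in at_right R. Z \<le> mc L"
      proof (rule eventually_at_rightI[OF _ b])
        fix L assume L: "L \<in> {R<..<1 / k Z'}"
        then have "k Z' < 1 / L" using kZ R by (simp add: field_simps)
        then have "Z' < mc L" using less_iff[of Z' "mc L"] mc[of L] L by (auto simp: Z'_def)
        then show "Z \<le> mc L" by (simp add: Z'_def)
      qed
    qed
    show "(mc \<longlongrightarrow> \<mu>) at_top"
    proof (rule order_tendstoI)
      fix c assume c: "c < \<mu>"
      show "\<forall>\<^sub>F L in at_top. c < mc L"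
        using eventually_gt_at_top[of R] by eventually_elim (use mc c in force)
    next
      fix c assume c: "\<mu> < c"
      have kc: "0 < k c" using mono[of \<mu> c] k0 c by auto
      show "\<forall>\<^sub>F L in at_top. mc L < c"
        using eventually_gt_at_top[of "max R (1 / k c)"]
      proof eventually_elim
        fix L assume L: "L > max R (1 / k c)"
        then have "1 / L < k c" using kc R by (simp add: field_simps)
        then show "mc L < c" using less_iff[of "mc L" c] mc[of L] L c by auto
      qed
    qed
  qed (use mc in auto)
qed

text \<open>The least total variation that carries a solution from \<open>a\<close> to \<open>b\<close> with rates at most \<open>m\<close>: time is spent at \<open>1 / (m + f x)\<close> per unit length, and variation at
rate \<open>m\<close>.\<close>

definition crossing_price :: "(real \<Rightarrow> real) \<Rightarrow> real \<Rightarrow> real \<Rightarrow> real \<Rightarrow> real" where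
  "crossing_price f a b m = integral {a..b} (\<lambda>x. m / (m + f x))"

context
  fixes f :: "real \<Rightarrow> real" and a b K \<mu> :: real
  assumes ab: "a < b" and lip: "K-lipschitz_on {a..b} f"
    and fa: "f a = 0" and fb: "f b = 0" and neg: "\<And>x. a < x \<Longrightarrow> x < b \<Longrightarrow> f x < 0"
    and \<mu>: "\<mu> = - (INF x\<in>{a..b}. f x)"
begin

lemma price_f_cont: "continuous_on {a..b} f"
  using lip by (rule lipschitz_on_continuous_on)

lemma price_minimiser:
  obtains x0 where "a < x0" "x0 < b" "f x0 = - \<mu>" "\<And>x. x \<in> {a..b} \<Longrightarrow> - \<mu> \<le> f x"
proof -
  have "{a..b} \<noteq> {}" using ab by auto
  from continuous_attains_inf[OF compact_Icc this price_f_cont]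
  obtain x0 where x0: "x0 \<in> {a..b}" "\<And>x. x \<in> {a..b} \<Longrightarrow> f x0 \<le> f x" by blast
  have "(INF x\<in>{a..b}. f x) = f x0" by (rule cInf_eq_minimum) (use x0 in auto)
  then have eq: "f x0 = - \<mu>" using \<mu> by simp
  have "f x0 \<le> f ((a + b) / 2)" using x0(2)[of "(a + b) / 2"] ab by auto
  then have "f x0 < 0" using neg[of "(a + b) / 2"] ab by auto
  then have "x0 \<noteq> a" "x0 \<noteq> b" using fa fb by auto
  then show thesis using that[of x0] x0 eq by auto
qed

lemma price_mu_pos: "\<mu> > 0"
  by (rule price_minimiser) (use neg in force)

lemma price_f_bounds: "x \<in> {a..b} \<Longrightarrow> - \<mu> \<le> f x" "x \<in> {a..b} \<Longrightarrow> f x \<le> 0"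
proof -
  show "- \<mu> \<le> f x" if "x \<in> {a..b}" by (rule price_minimiser) (use that in auto)
  show "f x \<le> 0" if "x \<in> {a..b}" using neg[of x] fa fb that by (cases "x = a"; cases "x = b") auto
qed

lemma price_integrand_cont: "m > \<mu> \<Longrightarrow> continuous_on {a..b} (\<lambda>x. m / (m + f x))"
  using price_f_bounds(1) by (intro continuous_intros price_f_cont) force

lemma price_integrable: "m > \<mu> \<Longrightarrow> (\<lambda>x. m / (m + f x)) integrable_on {a..b}"
  by (intro integrable_continuous_real price_integrand_cont)

lemma price_lower: "m > \<mu> \<Longrightarrow> b - a \<le> crossing_price f a b m"
proof -
  assume m: "m > \<mu>"
  have "integral {a..b} (\<lambda>x. 1 :: real) \<le> crossing_price f a b m"
    unfolding crossing_price_def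
  proof (rule integral_le[OF _ price_integrable[OF m]])
    fix x assume "x \<in> {a..b}"
    from price_f_bounds[OF this] m show "1 \<le> m / (m + f x)" by (simp add: field_simps)
  qed auto
  then show ?thesis using ab by simp
qed

lemma price_upper: "m > \<mu> \<Longrightarrow> crossing_price f a b m \<le> (b - a) * (m / (m - \<mu>))"
proof -
  assume m: "m > \<mu>"
  have "crossing_price f a b m \<le> integral {a..b} (\<lambda>x. m / (m - \<mu>))"
    unfolding crossing_price_def
  proof (rule integral_le[OF price_integrable[OF m]])
    fix x assume "x \<in> {a..b}"
    from price_f_bounds[OF this] m price_mu_pos show "m / (m + f x) \<le> m / (m - \<mu>)"
      by (intro divide_left_mono mult_pos_pos) auto
  qed auto
  then show ?thesis using ab by simp
qed

lemma price_strict_antimono: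
  assumes m: "\<mu> < m" "m < m'" shows "crossing_price f a b m' < crossing_price f a b m"
  unfolding crossing_price_def
proof (rule integral_strict_mono_ae[OF ab])
  show "negligible {a, b}" by simp
  fix x assume x: "x \<in> {a..b} - {a, b}"
  then have fx: "f x < 0" "- \<mu> \<le> f x" using neg price_f_bounds by auto
  have "0 < (m' - m) * (- f x)" using fx m by (intro mult_pos_pos) auto
  then have "m' * (m + f x) < m * (m' + f x)" by (simp add: algebra_simps)
  then show "m' / (m' + f x) < m / (m + f x)" using fx m by (simp add: divide_simps)
qed (use m price_integrable in auto)

lemma price_continuous: "continuous_on {\<mu><..} (crossing_price f a b)"
proof -
  have "continuous_on {\<mu><..} (\<lambda>m. integral (cbox a b) (\<lambda>x. m / (m + f x)))"
  proof (rule integral_continuous_on_param)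
    have "continuous_on ({\<mu><..} \<times> cbox a b) (\<lambda>p. fst p / (fst p + f (snd p)))"
      using price_f_bounds(1)
      by (intro continuous_intros continuous_on_compose2[OF price_f_cont]) force+
    then show "continuous_on ({\<mu><..} \<times> cbox a b) (\<lambda>(m, x). m / (m + f x))"
      by (simp add: case_prod_unfold)
  qed
  then show ?thesis by (simp add: crossing_price_def[abs_def])
qed

text \<open>Near the minimiser \<open>x0\<close> of \<open>f\<close> the denominator \<open>m + f x\<close> is at most \<open>(m - \<mu>) + K' (x - x0)\<close> by the Lipschitz bound,
and the reciprocal of this has a logarithmically divergent integral as \<open>m\<close> approaches \<open>\<mu>\<close>.\<close>

lemma price_blowup:
  obtains c K' where "c > 0" "K' > 0" "\<And>m. m > \<mu> \<Longrightarrow> (\<mu> / K') * ln (1 + c / (m - \<mu>)) \<le> crossing_price f a b m"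
proof -
  obtain x0 where x0: "a < x0" "x0 < b" "f x0 = - \<mu>" by (rule price_minimiser) blast
  define K' where "K' = K + 1"
  have K': "K' > 0" using lipschitz_on_nonneg[OF lip] by (simp add: K'_def)
  show thesis
  proof (rule that[of "K' * (b - x0)" K'])
    fix m assume m: "m > \<mu>"
    define G where "G x = (m / K') * ln ((m - \<mu>) + K' * (x - x0))" for x
    have pos: "(m - \<mu>) + K' * (x - x0) > 0" if "x \<in> {x0..b}" for x
      using m K' that by (intro add_pos_nonneg) auto
    have int: "((\<lambda>x. m / ((m - \<mu>) + K' * (x - x0))) has_integral (G b - G x0)) {x0..b}"
    proof (rule fundamental_theorem_of_calculus)
      fix x assume x: "x \<in> {x0..b}"
      have "(G has_real_derivative (m / ((m - \<mu>) + K' * (x - x0)))) (at x within {x0..b})"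
        unfolding G_def using pos[OF x] K'
        by (auto intro!: derivative_eq_intros)
      then show "(G has_vector_derivative (m / ((m - \<mu>) + K' * (x - x0)))) (at x within {x0..b})"
        by (simp add: has_real_derivative_iff_has_vector_derivative)
    qed (use x0 in simp)
    have "G b - G x0 = (m / K') * (ln ((m - \<mu>) + K' * (b - x0)) - ln (m - \<mu>))"
      by (simp add: G_def algebra_simps)
    also have "\<dots> = (m / K') * ln (((m - \<mu>) + K' * (b - x0)) / (m - \<mu>))"
      using pos[of b] m x0 by (subst ln_div) auto
    also have "((m - \<mu>) + K' * (b - x0)) / (m - \<mu>) = 1 + K' * (b - x0) / (m - \<mu>)"
      using m by (simp add: field_simps)
    finally have G: "G b - G x0 = (m / K') * ln (1 + K' * (b - x0) / (m - \<mu>))" .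
    have "(\<mu> / K') * ln (1 + K' * (b - x0) / (m - \<mu>)) \<le> G b - G x0"
      unfolding G using m K' x0 by (intro mult_right_mono divide_right_mono) auto
    also have "G b - G x0 = integral {x0..b} (\<lambda>x. m / ((m - \<mu>) + K' * (x - x0)))"
      using int by (simp add: integral_unique)
    also have "\<dots> \<le> integral {x0..b} (\<lambda>x. m / (m + f x))"
    proof (rule integral_le)
      show "(\<lambda>x. m / (m + f x)) integrable_on {x0..b}"
        by (rule integrable_on_subinterval[OF price_integrable[OF m]]) (use x0 in auto)
      fix x assume x: "x \<in> {x0..b}"
      have "\<bar>f x - f x0\<bar> \<le> K * \<bar>x - x0\<bar>"
        using lipschitz_onD[OF lip, of x x0] x x0 by (simp add: dist_real_def)
      then have "f x - f x0 \<le> K * (x - x0)" using x by simp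
      moreover have "K' * (x - x0) = K * (x - x0) + (x - x0)" by (simp add: K'_def algebra_simps)
      ultimately have "f x \<le> - \<mu> + K' * (x - x0)" using x x0 by simp
      moreover have "m + f x > 0" using price_f_bounds(1)[of x] x x0 m by auto
      ultimately show "m / ((m - \<mu>) + K' * (x - x0)) \<le> m / (m + f x)"
        using pos[OF x] m price_mu_pos by (intro divide_left_mono mult_pos_pos) auto
    qed (use int in auto)
    also have "\<dots> \<le> crossing_price f a b m"
      unfolding crossing_price_def
    proof (rule integral_subset_le)
      show "(\<lambda>x. m / (m + f x)) integrable_on {x0..b}"
        by (rule integrable_on_subinterval[OF price_integrable[OF m]]) (use x0 in auto)
      show "\<forall>x\<in>{a..b}. 0 \<le> m / (m + f x)" using price_f_bounds(1) m price_mu_pos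
        by (auto intro!: divide_nonneg_nonneg) force
    qed (use x0 price_integrable[OF m] in auto)
    finally show "(\<mu> / K') * ln (1 + K' * (b - x0) / (m - \<mu>)) \<le> crossing_price f a b m" .
  qed (use x0 K' in auto)
qed

lemma price_profile:
  obtains k where "budget_profile k (ereal \<mu>) (1 / (b - a))" "\<And>m. m > \<mu> \<Longrightarrow> k m = 1 / crossing_price f a b m"
proof -
  let ?P = "crossing_price f a b"
  define k where "k m = (if m > \<mu> then 1 / ?P m else 0)" for m
  have Ppos: "?P m > 0" if "m > \<mu>" for m using price_lower[OF that] ab by linarith
  have c1: "continuous_on {\<mu><..} k"
  proof (rule continuous_on_eq)
    show "continuous_on {\<mu><..} (\<lambda>m. 1 / ?P m)"
      using Ppos by (intro continuous_intros price_continuous) force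
  qed (simp add: k_def)
  have right: "(k \<longlongrightarrow> 0) (at_right \<mu>)"
  proof -
    obtain c K' where c: "c > 0" "K' > 0" "\<And>m. m > \<mu> \<Longrightarrow> (\<mu> / K') * ln (1 + c / (m - \<mu>)) \<le> ?P m"
      by (rule price_blowup) blast
    have "filterlim (\<lambda>m. m - \<mu>) (at_right 0) (at_right \<mu>)"
      by (rule filterlim_at_withinI)
        (auto intro!: tendsto_eq_intros simp: eventually_at_filter)
    then have "filterlim (\<lambda>m. inverse (m - \<mu>)) at_top (at_right \<mu>)"
      by (rule filterlim_compose[OF filterlim_inverse_at_top_right])
    then have "filterlim (\<lambda>m. c * inverse (m - \<mu>)) at_top (at_right \<mu>)"
      by (rule filterlim_tendsto_pos_mult_at_top[OF tendsto_const c(1)])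
    then have "filterlim (\<lambda>m. 1 + c * inverse (m - \<mu>)) at_top (at_right \<mu>)"
      by (rule filterlim_tendsto_add_at_top[OF tendsto_const])
    then have "filterlim (\<lambda>m. ln (1 + c * inverse (m - \<mu>))) at_top (at_right \<mu>)"
      by (rule filterlim_compose[OF ln_at_top])
    then have "filterlim (\<lambda>m. (\<mu> / K') * ln (1 + c * inverse (m - \<mu>))) at_top (at_right \<mu>)"
      using price_mu_pos c by (intro filterlim_tendsto_pos_mult_at_top[OF tendsto_const]) auto
    then have P: "filterlim ?P at_top (at_right \<mu>)"
    proof (rule filterlim_at_top_mono)
      show "\<forall>\<^sub>F m in at_right \<mu>. \<mu> / K' * ln (1 + c * inverse (m - \<mu>)) \<le> ?P m"
        using c(3) by (auto simp: eventually_at_filter divide_inverse intro!: always_eventually)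
    qed
    have "((\<lambda>m. inverse (?P m)) \<longlongrightarrow> 0) (at_right \<mu>)" by (rule tendsto_inverse_0_at_top[OF P])
    then show ?thesis
      by (rule Lim_transform_eventually) (auto simp: eventually_at_filter k_def divide_inverse intro!: always_eventually)
  qed
  have left: "(k \<longlongrightarrow> 0) (at_left \<mu>)"
    by (rule Lim_transform_eventually[OF tendsto_const]) (auto simp: eventually_at_filter k_def intro!: always_eventually)
  have cont: "isCont k m" for m
  proof -
    consider "m < \<mu>" | "m = \<mu>" | "m > \<mu>" by linarith
    then show ?thesis
    proof cases
      case 1
      have "continuous_on {..<\<mu>} k" by (rule continuous_on_eq[of _ "\<lambda>_. 0"]) (auto simp: k_def)
      then show ?thesis using 1 by (simp add: continuous_on_eq_continuous_at)
    next
      case 2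
      have "k \<mu> = 0" by (simp add: k_def)
      then show ?thesis using left right 2 by (simp add: isCont_def filterlim_split_at)
    next
      case 3 then show ?thesis using c1 by (simp add: continuous_on_eq_continuous_at)
    qed
  qed
  have top: "(k \<longlongrightarrow> 1 / (b - a)) at_top"
  proof -
    have "filterlim (\<lambda>m. - \<mu> + m) at_top at_top"
      by (rule filterlim_tendsto_add_at_top[OF tendsto_const filterlim_ident])
    then have "filterlim (\<lambda>m. m - \<mu>) at_top at_top" by simp
    then have "((\<lambda>m. \<mu> * inverse (m - \<mu>)) \<longlongrightarrow> \<mu> * 0) at_top"
      by (intro tendsto_mult tendsto_const tendsto_inverse_0_at_top)
    from tendsto_mult[OF tendsto_const tendsto_add[OF tendsto_const this], of "b - a" 1]
    have up: "((\<lambda>m. (b - a) * (1 + \<mu> * inverse (m - \<mu>))) \<longlongrightarrow> b - a) at_top" by simp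
    have "(?P \<longlongrightarrow> b - a) at_top"
    proof (rule tendsto_sandwich[OF _ _ tendsto_const up])
      show "\<forall>\<^sub>F m in at_top. b - a \<le> ?P m"
        using eventually_gt_at_top[of \<mu>] by eventually_elim (rule price_lower)
      show "\<forall>\<^sub>F m in at_top. ?P m \<le> (b - a) * (1 + \<mu> * inverse (m - \<mu>))"
        using eventually_gt_at_top[of \<mu>]
      proof eventually_elim
        fix m assume m: "m > \<mu>"
        have "m / (m - \<mu>) = 1 + \<mu> * inverse (m - \<mu>)" using m by (simp add: field_simps)
        then show "?P m \<le> (b - a) * (1 + \<mu> * inverse (m - \<mu>))" using price_upper[OF m] by simp
      qed
    qed
    then have "((\<lambda>m. 1 / ?P m) \<longlongrightarrow> 1 / (b - a)) at_top"
      using ab by (intro tendsto_intros) auto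
    then show ?thesis
      by (rule Lim_transform_eventually)
        (use eventually_gt_at_top[of \<mu>] in \<open>eventually_elim, simp add: k_def\<close>)
  qed
  have "budget_profile k (ereal \<mu>) (1 / (b - a))"
    unfolding budget_profile_def
  proof (intro conjI allI impI)
    show "continuous_on UNIV k" using cont by (simp add: continuous_at_imp_continuous_on)
    show "0 \<le> k m" for m using Ppos[of m] by (simp add: k_def less_imp_le)
    show "k m = 0" if "ereal m \<le> ereal \<mu>" for m using that by (simp add: k_def)
    show "k m < k m'" if "ereal \<mu> \<le> ereal m \<and> m < m'" for m m'
    proof (cases "m = \<mu>")
      case True then show ?thesis using that Ppos[of m'] by (simp add: k_def)
    next
      case False
      then have "\<mu> < m" "m < m'" using that by auto
      then show ?thesis using price_strict_antimono[of m m'] Ppos[of m'] Ppos[of m]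
        by (simp add: k_def frac_less2)
    qed
  qed (rule top)
  then show thesis by (rule that) (simp add: k_def)
qed

end

section \<open>Ramps that carry a solution to the boundary\<close>

lemma deriv_le_lipschitz:
  fixes g :: "real \<Rightarrow> real"
  assumes lip: "C-lipschitz_on UNIV g" and d: "g differentiable (at t)"
  shows "\<bar>deriv g t\<bar> \<le> C"
proof -
  have "(g has_real_derivative deriv g t) (at t)" using d by (simp add: DERIV_deriv_iff_real_differentiable)
  then have "((\<lambda>z. (g z - g t) / (z - t)) \<longlongrightarrow> deriv g t) (at t)" by (simp add: has_field_derivative_iff)
  then have "((\<lambda>z. \<bar>(g z - g t) / (z - t)\<bar>) \<longlongrightarrow> \<bar>deriv g t\<bar>) (at t)" by (rule tendsto_rabs)
  then show ?thesis
  proof (rule tendsto_upperbound)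
    have "\<bar>(g z - g t) / (z - t)\<bar> \<le> C" if "z \<noteq> t" for z
      using lipschitz_onD[OF lip, of z t] that by (simp add: dist_real_def divide_simps)
    then show "\<forall>\<^sub>F z in at t. \<bar>(g z - g t) / (z - t)\<bar> \<le> C" by (auto simp: eventually_at_filter)
  qed simp
qed

definition ramp :: "real \<Rightarrow> real \<Rightarrow> real \<Rightarrow> real" where
  "ramp c T t = c * max 0 (min T t)"

lemma ramp_lipschitz: "\<bar>c\<bar>-lipschitz_on UNIV (ramp c T)"
proof (rule lipschitz_onI)
  fix x y :: real
  have "\<bar>max 0 (min T x) - max 0 (min T y)\<bar> \<le> \<bar>x - y\<bar>" by (auto simp: max_def min_def)
  then have "\<bar>c\<bar> * \<bar>max 0 (min T x) - max 0 (min T y)\<bar> \<le> \<bar>c\<bar> * \<bar>x - y\<bar>" by (intro mult_left_mono) auto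
  then show "dist (ramp c T x) (ramp c T y) \<le> \<bar>c\<bar> * dist x y"
    by (simp add: ramp_def dist_real_def abs_mult[symmetric] right_diff_distrib)
qed simp

lemma ramp_derivative:
  assumes T: "T > 0"
  shows "t < 0 \<Longrightarrow> (ramp c T has_real_derivative 0) (at t)"
    and "0 < t \<Longrightarrow> t < T \<Longrightarrow> (ramp c T has_real_derivative c) (at t)"
    and "T < t \<Longrightarrow> (ramp c T has_real_derivative 0) (at t)"
proof -
  show "(ramp c T has_real_derivative 0) (at t)" if "t < 0"
    by (rule has_field_derivative_transform_within_open[of "\<lambda>_. 0" _ _ "{..<0}"])
      (use that T in \<open>auto simp: ramp_def\<close>)
  have "((\<lambda>t. c * t) has_real_derivative c) (at t)" by (auto intro!: derivative_eq_intros)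
  then show "(ramp c T has_real_derivative c) (at t)" if "0 < t" "t < T"
    by (rule has_field_derivative_transform_within_open[of _ _ _ "{0<..<T}"])
      (use that T in \<open>auto simp: ramp_def\<close>)
  show "(ramp c T has_real_derivative 0) (at t)" if "T < t"
    by (rule has_field_derivative_transform_within_open[of "\<lambda>_. c * T" _ _ "{T<..}"])
      (use that T in \<open>auto simp: ramp_def\<close>)
qed

lemma ramp_deriv:
  assumes "T > 0"
  shows "t < 0 \<Longrightarrow> deriv (ramp c T) t = 0"
    and "0 < t \<Longrightarrow> t < T \<Longrightarrow> deriv (ramp c T) t = c"
    and "T < t \<Longrightarrow> deriv (ramp c T) t = 0"
  using ramp_derivative[OF assms] by (auto intro: DERIV_imp_deriv)

lemma ramp_in_Lambda:
  assumes T: "T > 0"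
  shows "ramp c T \<in> Lambda (\<bar>c\<bar> * T)"
proof -
  have d2: "(deriv (ramp c T) has_real_derivative 0) (at t)" if "T < t" for t
    by (rule has_field_derivative_transform_within_open[of "\<lambda>_. 0" _ _ "{T<..}"])
      (use that ramp_deriv(3)[OF T] in auto)
  have d2': "deriv (deriv (ramp c T)) t = 0" if "T < t" for t
    using d2[OF that] by (rule DERIV_imp_deriv)
  have "((\<lambda>t. \<bar>c\<bar>) has_integral (\<bar>c\<bar> * T)) {0..T}"
    using has_integral_const_real[of "\<bar>c\<bar>" 0 T] T by (simp add: mult.commute)
  then have "((\<lambda>t. if t \<in> {0..T} then \<bar>c\<bar> else 0) has_integral (\<bar>c\<bar> * T)) UNIV"
    by (simp only: has_integral_restrict_UNIV)
  then have int: "((\<lambda>t. \<bar>deriv (ramp c T) t\<bar>) has_integral (\<bar>c\<bar> * T)) UNIV"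
  proof (rule has_integral_spike[rotated 2])
    show "negligible {0, T}" by simp
    fix t assume "t \<in> UNIV - {0, T}"
    then consider "t < 0" | "0 < t" "t < T" | "T < t" by force
    then show "\<bar>deriv (ramp c T) t\<bar> = (if t \<in> {0..T} then \<bar>c\<bar> else 0)"
      by cases (use ramp_deriv[OF T] T in auto)
  qed
  have bot: "(ramp c T \<longlongrightarrow> 0) at_bot"
    by (rule tendsto_eventually)
      (use eventually_le_at_bot[of 0] in \<open>eventually_elim, use T in \<open>simp add: ramp_def\<close>\<close>)
  have top: "(ramp c T \<longlongrightarrow> c * T) at_top"
    by (rule tendsto_eventually)
      (use eventually_ge_at_top[of T] in \<open>eventually_elim, use T in \<open>simp add: ramp_def\<close>\<close>)
  have C2: "C2_on (ramp c T) {T<..}"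
    unfolding C2_on_def
  proof (intro conjI ballI)
    fix t assume "t \<in> {T<..}"
    then show "ramp c T differentiable at t" "deriv (ramp c T) differentiable at t"
      using ramp_derivative(3)[OF T] d2 by (auto simp: real_differentiable_def)
  next
    show "continuous_on {T<..} (deriv (deriv (ramp c T)))"
      by (rule continuous_on_eq[of _ "\<lambda>_. 0"]) (use d2' in auto)
  qed
  have tail: "((\<lambda>t. deriv (deriv (ramp c T)) t / exp (- 1 * t)) \<longlongrightarrow> 0) at_top"
    by (rule tendsto_eventually)
      (use eventually_gt_at_top[of T] in \<open>eventually_elim, simp add: d2'\<close>)
  show ?thesis
    unfolding Lambda_def mem_Collect_eq
  proof (intro conjI)
    show "\<exists>C. C-lipschitz_on UNIV (ramp c T)" using ramp_lipschitz by blast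
    show "\<exists>l. (ramp c T \<longlongrightarrow> l) at_top" using top by blast
    show "\<exists>S. C2_on (ramp c T) {S<..}" using C2 by blast
    show "\<exists>\<rho>>0. \<exists>l. ((\<lambda>t. deriv (deriv (ramp c T)) t / exp (- \<rho> * t)) \<longlongrightarrow> l) at_top"
      using tail zero_less_one by blast
  qed (fact bot int)+
qed

lemma ramp_max_rate:
  assumes "T > 0"
  shows "\<exists>t. ramp c T differentiable (at t) \<and> \<bar>deriv (ramp c T) t\<bar> = \<bar>c\<bar>"
    and "\<forall>t. ramp c T differentiable (at t) \<longrightarrow> \<bar>deriv (ramp c T) t\<bar> \<le> \<bar>c\<bar>"
proof -
  have "ramp c T differentiable (at (T / 2))" "deriv (ramp c T) (T / 2) = c"
    using ramp_derivative(2)[of T "T / 2" c] ramp_deriv(2)[of T "T / 2" c] assms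
    by (auto simp: real_differentiable_def)
  then show "\<exists>t. ramp c T differentiable (at t) \<and> \<bar>deriv (ramp c T) t\<bar> = \<bar>c\<bar>"
    by (intro exI[of _ "T / 2"]) simp
  show "\<forall>t. ramp c T differentiable (at t) \<longrightarrow> \<bar>deriv (ramp c T) t\<bar> \<le> \<bar>c\<bar>"
    using deriv_le_lipschitz[OF ramp_lipschitz, of c T] by simp
qed

text \<open>Under the constant rate \<open>m\<close> the position \<open>x\<close> is reached at the time \<open>\<tau> x\<close>, the integral of \<open>1 / (m + f)\<close>; the solution is the inverse function
of \<open>\<tau>\<close>, continued by the rest points \<open>a\<close> and \<open>b\<close>. The values of \<open>u\<close> at the two corners \<open>0\<close> and \<open>T\<close> are left open because the derivative of a
ramp is unspecified there.\<close>

lemma bang_bang_transit: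
  fixes f u :: "real \<Rightarrow> real"
  assumes ab: "a < b" and f: "continuous_on UNIV f" and fa: "f a = 0" and fb: "f b = 0"
    and m: "m > 0" and pos: "\<And>x. x \<in> {a..b} \<Longrightarrow> m + f x > 0"
    and T: "T = crossing_price f a b m / m"
    and u: "\<And>t. t < 0 \<Longrightarrow> u t = 0" "\<And>t. 0 < t \<Longrightarrow> t < T \<Longrightarrow> u t = m" "\<And>t. T < t \<Longrightarrow> u t = 0"
    and uint: "\<And>p q. u absolutely_integrable_on {p..q}"
  shows "\<exists>y. caratheodory_solution f u UNIV y \<and> (y \<longlongrightarrow> a) at_bot \<and> (y \<longlongrightarrow> b) at_top"
proof -
  define h where "h x = 1 / (m + f x)" for x
  have hc: "continuous_on {a..b} h"
    unfolding h_def using pos by (intro continuous_intros continuous_on_subset[OF f]) force+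
  define \<tau> where "\<tau> x = integral {a..x} h" for x
  have \<tau>d: "(\<tau> has_real_derivative h x) (at x within {a..b})" if "x \<in> {a..b}" for x
    unfolding \<tau>_def by (rule integral_has_real_derivative[OF hc that])
  have \<tau>c: "continuous_on {a..b} \<tau>" using \<tau>d by (rule DERIV_continuous_on)
  have \<tau>a: "\<tau> a = 0" by (simp add: \<tau>_def)
  have \<tau>b: "\<tau> b = T"
  proof -
    have "crossing_price f a b m = integral {a..b} (\<lambda>x. m * h x)"
      by (simp add: crossing_price_def h_def)
    also have "\<dots> = m * \<tau> b" by (simp add: \<tau>_def)
    finally show ?thesis using m T by simp
  qed
  have \<tau>mono: "\<tau> x < \<tau> z" if "a \<le> x" "x < z" "z \<le> b" for x z
  proof -
    have "\<exists>\<xi>\<in>{x<..<z}. \<tau> z - \<tau> x = (\<lambda>k. h \<xi> * k) (z - x)"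
    proof (rule mvt_simple[OF that(2)])
      fix r assume "x \<le> r" "r \<le> z"
      then have "(\<tau> has_real_derivative h r) (at r within {x..z})"
        using that by (intro DERIV_subset[OF \<tau>d]) auto
      then show "(\<tau> has_derivative (\<lambda>k. h r * k)) (at r within {x..z})"
        by (simp add: has_field_derivative_def)
    qed
    then obtain \<xi> where \<xi>: "\<xi> \<in> {x<..<z}" "\<tau> z - \<tau> x = h \<xi> * (z - x)" by blast
    have "h \<xi> > 0" using pos[of \<xi>] \<xi>(1) that by (simp add: h_def)
    then have "h \<xi> * (z - x) > 0" using that by simp
    then show ?thesis using \<xi>(2) by linarith
  qed
  have T0: "T > 0" using \<tau>mono[of a b] ab \<tau>a \<tau>b by simp
  have inj: "inj_on \<tau> {a..b}"
    by (rule linorder_inj_onI) (use \<tau>mono in force)+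
  define g where "g = the_inv_into {a..b} \<tau>"
  have g\<tau>: "g (\<tau> x) = x" if "x \<in> {a..b}" for x unfolding g_def by (rule the_inv_into_f_f[OF inj that])
  have im: "\<tau> ` {a..b} = {0..T}"
  proof (intro set_eqI iffI)
    fix s assume "s \<in> \<tau> ` {a..b}"
    then obtain x where x: "x \<in> {a..b}" "s = \<tau> x" by blast
    then show "s \<in> {0..T}" using \<tau>mono[of a x] \<tau>mono[of x b] \<tau>a \<tau>b by (cases "x = a"; cases "x = b") auto
  next
    fix s assume "s \<in> {0..T}"
    then have "\<exists>x\<ge>a. x \<le> b \<and> \<tau> x = s" by (intro IVT' \<tau>c) (use \<tau>a \<tau>b ab in auto)
    then show "s \<in> \<tau> ` {a..b}" by auto
  qed
  have gin: "g s \<in> {a..b}" and \<tau>g: "\<tau> (g s) = s" if "s \<in> {0..T}" for s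
  proof -
    have "s \<in> \<tau> ` {a..b}" using that by (simp only: im)
    then obtain x where "x \<in> {a..b}" "s = \<tau> x" by (rule imageE)
    then show "g s \<in> {a..b}" "\<tau> (g s) = s" using g\<tau> by auto
  qed
  have gc: "continuous_on {0..T} g"
    using continuous_on_inv[OF \<tau>c compact_Icc, of g] g\<tau> im by auto
  have g0: "g 0 = a" using g\<tau>[of a] \<tau>a ab by simp
  have gT: "g T = b" using g\<tau>[of b] \<tau>b ab by simp
  have gd: "(g has_real_derivative (f (g t) + m)) (at t)" if t: "0 < t" "t < T" for t
  proof -
    have gt: "g t \<in> {a..b}" "\<tau> (g t) = t" using gin[of t] \<tau>g[of t] t by auto
    then have "g t \<noteq> a" "g t \<noteq> b" using \<tau>a \<tau>b t by auto
    then have gt': "g t \<in> {a<..<b}" using gt by auto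
    have "(\<tau> has_real_derivative h (g t)) (at (g t) within {a<..<b})"
      by (rule DERIV_subset[OF \<tau>d]) (use gt' in auto)
    moreover have "at (g t) within {a<..<b} = at (g t)"
      by (rule at_within_open[OF gt']) simp
    ultimately have "(\<tau> has_real_derivative h (g t)) (at (g t))" by simp
    moreover have "isCont g t"
      using gc t by (intro continuous_on_interior[of "{0..T}"]) auto
    moreover have "h (g t) \<noteq> 0" using pos[OF gt(1)] by (simp add: h_def)
    ultimately have "(g has_real_derivative inverse (h (g t))) (at t)"
      using t \<tau>g by (intro DERIV_inverse_function[where f=\<tau> and a=0 and b=T]) auto
    then show ?thesis by (simp add: h_def add.commute)
  qed
  define y where "y t = g (max 0 (min T t))" for t
  have yin: "max 0 (min T t) \<in> {0..T}" for t using T0 by auto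
  have yc: "continuous_on UNIV y"
    unfolding y_def by (rule continuous_on_compose2[OF gc]) (use yin in \<open>auto intro!: continuous_intros\<close>)
  have yd: "(y has_real_derivative (f (y t) + u t)) (at t)" if "t \<notin> {0, T}" for t
  proof -
    have "t \<noteq> 0" "t \<noteq> T" using that by auto
    then consider "t < 0" | "0 < t" "t < T" | "T < t" by linarith
    then show ?thesis
    proof cases
      case 1
      have "(y has_real_derivative 0) (at t)"
        by (rule has_field_derivative_transform_within_open[of "\<lambda>_. a" _ _ "{..<0}"])
          (use 1 T0 g0 in \<open>auto simp: y_def\<close>)
      moreover have "y t = a" using 1 T0 g0 by (simp add: y_def)
      ultimately show ?thesis using u(1)[OF 1] fa by simp
    next
      case 2
      have "(y has_real_derivative (f (g t) + m)) (at t)"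
        by (rule has_field_derivative_transform_within_open[OF gd[OF 2], of "{0<..<T}"])
          (use 2 in \<open>auto simp: y_def\<close>)
      moreover have "y t = g t" using 2 by (simp add: y_def)
      ultimately show ?thesis using u(2)[OF 2] by simp
    next
      case 3
      have "(y has_real_derivative 0) (at t)"
        by (rule has_field_derivative_transform_within_open[of "\<lambda>_. b" _ _ "{T<..}"])
          (use 3 T0 gT in \<open>auto simp: y_def\<close>)
      moreover have "y t = b" using 3 T0 gT by (simp add: y_def)
      ultimately show ?thesis using u(3)[OF 3] fb by simp
    qed
  qed
  have "caratheodory_solution f u UNIV y"
    unfolding caratheodory_solution_def
  proof (intro conjI ballI impI)
    fix s t :: real assume st: "s \<le> t"
    have "continuous_on {s..t} (\<lambda>r. f (y r))"
      by (rule continuous_on_compose2[OF f continuous_on_subset[OF yc]]) auto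
    then have "(\<lambda>r. f (y r)) absolutely_integrable_on {s..t}" by (rule absolutely_integrable_continuous_real)
    then show "(\<lambda>r. f (y r) + u r) absolutely_integrable_on {s..t}" using uint by (rule set_integral_add)
    have "((\<lambda>r. f (y r) + u r) has_integral (y t - y s)) {s..t}"
    proof (rule fundamental_theorem_of_calculus_strong[OF _ st])
      show "finite {0, T}" by simp
      show "continuous_on {s..t} y" by (rule continuous_on_subset[OF yc]) simp
      fix r assume "r \<in> {s..t} - {0, T}"
      then show "(y has_vector_derivative f (y r) + u r) (at r)"
        using yd by (simp add: has_real_derivative_iff_has_vector_derivative)
    qed
    from integral_unique[OF this] show "y t = y s + integral {s..t} (\<lambda>r. f (y r) + u r)" by linarith
  qed simp
  moreover have "(y \<longlongrightarrow> a) at_bot"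
    by (rule tendsto_eventually)
      (use eventually_le_at_bot[of 0] in \<open>eventually_elim, use T0 g0 in \<open>simp add: y_def\<close>\<close>)
  moreover have "(y \<longlongrightarrow> b) at_top"
    by (rule tendsto_eventually)
      (use eventually_ge_at_top[of T] in \<open>eventually_elim, use T0 gT in \<open>simp add: y_def\<close>\<close>)
  ultimately show ?thesis by blast
qed

section \<open>The two sides of the basin\<close>

lemma C2_on_imp_lipschitz:
  assumes "C2_on f UNIV"
  shows "continuous_on UNIV f" and "\<exists>K. K-lipschitz_on {p..q} f"
proof -
  have d: "(f has_real_derivative deriv f x) (at x)" for x
    using assms by (simp add: C2_on_def DERIV_deriv_iff_real_differentiable)
  show "continuous_on UNIV f"
    using d by (meson DERIV_isCont continuous_at_imp_continuous_on)
  have "isCont (deriv f) x" for x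
    using assms by (simp add: C2_on_def differentiable_imp_continuous_within)
  then have dc: "continuous_on {p..q} (deriv f)" by (simp add: continuous_at_imp_continuous_on)
  show "\<exists>K. K-lipschitz_on {p..q} f"
  proof -
    have "bounded (deriv f ` {p..q})" by (intro compact_imp_bounded compact_continuous_image dc) auto
    then obtain K where K: "\<forall>x\<in>{p..q}. \<bar>deriv f x\<bar> \<le> K"
      unfolding bounded_iff by auto
    have "\<bar>K\<bar>-lipschitz_on {p..q} f"
    proof (rule lipschitz_onI)
      fix x y assume xy: "x \<in> {p..q}" "y \<in> {p..q}"
      obtain \<xi> where \<xi>: "\<xi> \<in> closed_segment y x" "f x - f y = deriv f \<xi> * (x - y)"
        using mvt_closed_segment[of p q f "deriv f" y x] xy d has_field_derivative_at_within by blast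
      have "closed_segment y x \<subseteq> {p..q}" using xy by (intro closed_segment_subset) auto
      then have "\<bar>deriv f \<xi>\<bar> \<le> K" using K \<xi>(1) by blast
      then have "\<bar>deriv f \<xi>\<bar> \<le> \<bar>K\<bar>" by linarith
      then show "dist (f x) (f y) \<le> \<bar>K\<bar> * dist x y"
        unfolding dist_real_def \<xi>(2) abs_mult by (intro mult_right_mono) auto
    qed simp
    then show ?thesis by blast
  qed
qed

text \<open>If \<open>f x0 \<ge> 0\<close> then \<open>f z \<ge> - K (x0 - z)\<close> just below \<open>x0\<close>. By Gronwall, a solution that leaves \<open>x0\<close> downwards
keeps \<open>(x0 - x) exp (- K r)\<close> from growing, so it never leaves. This excludes rest points and repelling points at once.\<close>

lemma basin_points_move_left:
  assumes lip: "\<And>p q. \<exists>K. K-lipschitz_on {p..q} f" and x0: "x0 \<in> basin f a" "a < x0"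
  shows "f x0 < 0"
proof (rule ccontr)
  assume "\<not> f x0 < 0"
  then have f0: "f x0 \<ge> 0" by simp
  obtain x where x: "forward_solution f x0 x" "(x \<longlongrightarrow> a) at_top" using x0(1) by (auto simp: basin_def)
  have xd: "(x has_real_derivative f (x t)) (at t within {0..})" if "t \<ge> 0" for t
    using x(1) that by (simp add: forward_solution_def)
  have xc: "continuous_on {0..} x" by (rule DERIV_continuous_on) (use xd in auto)
  define c where "c = (a + x0) / 2"
  have c: "a < c" "c < x0" using x0(2) by (auto simp: c_def)
  have "\<forall>\<^sub>F t in at_top. x t < c" using x(2) c(1) by (rule order_tendstoD)
  then have "\<forall>\<^sub>F t in at_top. x t < c \<and> t \<ge> 0" using eventually_ge_at_top[of 0] by eventually_elim auto
  then obtain q where q: "x q < c" "q \<ge> 0"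
    using eventually_happens'[OF trivial_limit_at_top_linorder] by blast
  have cm: "continuous_on {0..q} (\<lambda>t. - x t)"
    by (intro continuous_on_minus continuous_on_subset[OF xc]) auto
  have ends: "- x 0 \<le> - x0" "- x0 < - c" "- c \<le> - x q"
    using x(1) c q by (simp_all add: forward_solution_def)
  obtain s t where st: "0 \<le> s" "s < t" "- x s = - x0" "- x t = - c"
    and between: "\<And>r. s \<le> r \<Longrightarrow> r \<le> t \<Longrightarrow> - x r \<in> {- x0..- c}"
    by (rule last_crossing[OF cm q(2) ends]) blast
  obtain K where K: "K-lipschitz_on {c..x0} f" using lip by blast
  define G where "G r = (x0 - x r) * exp (- K * r)" for r
  have "\<exists>\<xi>\<in>{s<..<t}. G t - G s = (\<lambda>k. ((- f (x \<xi>) - K * (x0 - x \<xi>)) * exp (- K * \<xi>)) * k) (t - s)"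
  proof (rule mvt_simple[OF st(2)])
    fix r assume r: "s \<le> r" "r \<le> t"
    have "(x has_real_derivative f (x r)) (at r within {s..t})"
      by (rule DERIV_subset[OF xd]) (use r st in auto)
    then have "(G has_real_derivative ((- f (x r) - K * (x0 - x r)) * exp (- K * r))) (at r within {s..t})"
      unfolding G_def by (auto intro!: derivative_eq_intros simp: algebra_simps)
    then show "(G has_derivative (\<lambda>k. ((- f (x r) - K * (x0 - x r)) * exp (- K * r)) * k)) (at r within {s..t})"
      by (simp add: has_field_derivative_def)
  qed
  then obtain \<xi> where \<xi>: "s < \<xi>" "\<xi> < t" "G t - G s = ((- f (x \<xi>) - K * (x0 - x \<xi>)) * exp (- K * \<xi>)) * (t - s)" by auto
  have x\<xi>: "x \<xi> \<in> {c..x0}" using between[of \<xi>] \<xi> by auto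
  have "\<bar>f (x \<xi>) - f x0\<bar> \<le> K * \<bar>x \<xi> - x0\<bar>"
    using lipschitz_onD[OF K x\<xi>, of x0] c by (simp add: dist_real_def)
  moreover have "\<bar>x \<xi> - x0\<bar> = x0 - x \<xi>" using x\<xi> by auto
  ultimately have "- f (x \<xi>) - K * (x0 - x \<xi>) \<le> 0" using f0 by (simp add: abs_le_iff)
  then have "G t - G s \<le> 0" unfolding \<xi>(3) using st by (intro mult_nonpos_nonneg) auto
  moreover have "G s = 0" using st by (simp add: G_def)
  moreover have "G t > 0" using st c by (simp add: G_def)
  ultimately show False by simp
qed

lemma basin_reflect:
  assumes "x0 \<in> basin f a" shows "- x0 \<in> basin (\<lambda>x. - f (- x)) (- a)"
proof -
  obtain x where x: "forward_solution f x0 x" "(x \<longlongrightarrow> a) at_top" using assms by (auto simp: basin_def)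
  have "forward_solution (\<lambda>x. - f (- x)) (- x0) (\<lambda>t. - x t)"
    using x(1) unfolding forward_solution_def by (auto intro!: derivative_eq_intros)
  moreover have "((\<lambda>t. - x t) \<longlongrightarrow> - a) at_top" using x(2) by (rule tendsto_minus)
  ultimately show ?thesis unfolding basin_def by blast
qed

text \<open>Comparing \<open>m (F + v)\<close> with \<open>\<bar>v\<bar> (m + F)\<close>: for \<open>v \<ge> 0\<close> the difference is \<open>(m - v) F\<close>.\<close>

lemma optimal_weight_inequality:
  fixes m F v :: real
  assumes F: "F < 0" "0 < m + F" and v: "\<bar>v\<bar> < m"
  shows "m / (m + F) * (F + v) < \<bar>v\<bar>"
proof -
  have m: "m > 0" using v by linarith
  have "m * (F + v) < \<bar>v\<bar> * (m + F)"
  proof (cases "v \<ge> 0")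
    case True
    have "(m - v) * F < 0" using True v F by (intro mult_pos_neg) auto
    then show ?thesis using True by (simp add: algebra_simps)
  next
    case False
    have "m * (F + v) < 0" using False F m by (intro mult_pos_neg) auto
    also have "0 \<le> \<bar>v\<bar> * (m + F)" using F by simp
    finally show ?thesis .
  qed
  then show ?thesis using F by (simp add: divide_simps)
qed

text \<open>Inputs with rate below \<open>m\<close> almost everywhere and total variation at most \<open>L\<close> keep the solution from \<open>a\<close> away from the right boundary \<open>\<beta>\<close>. The exceptional null set \<open>N\<close> is there for the
points of non-differentiability of an input.\<close>

definition budget_confines :: "(real \<Rightarrow> real) \<Rightarrow> real \<Rightarrow> ereal \<Rightarrow> real \<Rightarrow> real \<Rightarrow> bool" where
  "budget_confines f a \<beta> m L \<longleftrightarrow>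
     (\<forall>u J y T N. caratheodory_solution f u J y \<longrightarrow> {..T} \<subseteq> J \<longrightarrow> (y \<longlongrightarrow> a) at_bot \<longrightarrow>
        negligible N \<longrightarrow> (\<forall>t. t \<notin> N \<longrightarrow> \<bar>u t\<bar> < m) \<longrightarrow>
        (\<forall>p q. u absolutely_integrable_on {p..q}) \<longrightarrow>
        (\<forall>p q. integral {p..q} (\<lambda>t. \<bar>u t\<bar>) \<le> L) \<longrightarrow>
        (\<exists>hi. ereal hi < \<beta> \<and> (\<forall>t\<in>J. y t \<le> hi)))"

text \<open>The rate is left open at the corners \<open>0\<close> and \<open>T\<close>, so that both the derivative of a ramp and
its negative qualify.\<close>

definition pulse_escapes :: "(real \<Rightarrow> real) \<Rightarrow> real \<Rightarrow> real \<Rightarrow> real \<Rightarrow> bool" where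
  "pulse_escapes f a m T \<longleftrightarrow>
     (\<forall>u. (\<forall>t<0. u t = 0) \<longrightarrow> (\<forall>t. 0 < t \<and> t < T \<longrightarrow> u t = m) \<longrightarrow> (\<forall>t>T. u t = 0) \<longrightarrow>
        (\<forall>p q. u absolutely_integrable_on {p..q}) \<longrightarrow>
        (\<exists>y b. b \<noteq> a \<and> caratheodory_solution f u UNIV y \<and> (y \<longlongrightarrow> a) at_bot \<and> (y \<longlongrightarrow> b) at_top))"

text \<open>On the infinite side the constant weight \<open>1\<close> suffices: the solution cannot pass \<open>a + L + 1\<close>. On a finite side, a rate
\<open>m\<close> that is too small for the price to be finite is replaced by a slightly larger \<open>m'\<close> whose price is still at least \<open>L\<close>.\<close>

lemma one_sided_analysis:
  fixes f :: "real \<Rightarrow> real" and a :: real and \<beta> :: ereal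
  assumes f: "continuous_on UNIV f" and lip: "\<And>p q. \<exists>K. K-lipschitz_on {p..q} f"
    and fa: "f a = 0" and a\<beta>: "ereal a < \<beta>"
    and neg: "\<And>x. a < x \<Longrightarrow> ereal x < \<beta> \<Longrightarrow> f x < 0"
    and end0: "\<And>b. \<beta> = ereal b \<Longrightarrow> f b = 0"
  obtains k where
    "budget_profile k (mu_plus f a \<beta>) (if \<beta> = \<infinity> then 0 else 1 / (real_of_ereal \<beta> - a))"
    "\<And>m L. k m \<le> 1 / L \<Longrightarrow> 0 < L \<Longrightarrow> budget_confines f a \<beta> m L"
    "\<And>m L. k m = 1 / L \<Longrightarrow> 0 < L \<Longrightarrow> \<exists>T>0. 0 < m \<and> m * T = L \<and> pulse_escapes f a m T"
proof (cases "\<beta> = \<infinity>")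
  case True
  have neg': "f x < 0" if "a < x" for x using neg[of x] that True by simp
  show thesis
  proof (rule that[of "\<lambda>_. 0"])
    show "budget_profile (\<lambda>_. 0) (mu_plus f a \<beta>) (if \<beta> = \<infinity> then 0 else 1 / (real_of_ereal \<beta> - a))"
      using budget_profile_zero True by (simp add: mu_plus_def)
  next
    fix m L :: real assume L: "0 < L"
    show "budget_confines f a \<beta> m L"
      unfolding budget_confines_def
    proof (intro allI impI)
      fix u y :: "real \<Rightarrow> real" and J T N
      assume car: "caratheodory_solution f u J y" and J: "{..T} \<subseteq> J" and lim: "(y \<longlongrightarrow> a) at_bot"
        and "\<forall>p q. u absolutely_integrable_on {p..q}" "\<forall>p q. integral {p..q} (\<lambda>t. \<bar>u t\<bar>) \<le> L"
      note uint = this(4)[rule_format] and uL = this(5)[rule_format]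
    have "\<exists>B'>a. B' < a + L + 1 \<and> (\<forall>t\<in>J. y t \<le> B')"
    proof (rule cost_barrier[OF car J lim, where w="\<lambda>_. 1" and N="{}" and L=L])
      fix x t assume "a < x"
      then show "1 * (f x + u t) < \<bar>u t\<bar>" using neg'[of x] by auto
    qed (use L uint uL in auto)
    then show "\<exists>hi. ereal hi < \<beta> \<and> (\<forall>t\<in>J. y t \<le> hi)" using True by auto
    qed
  qed auto
next
  case False
  then obtain b where b: "\<beta> = ereal b" using a\<beta> by (cases \<beta>) auto
  have ab: "a < b" using a\<beta> b by simp
  have neg': "f x < 0" if "a < x" "x < b" for x using neg[of x] that b by simp
  have fb: "f b = 0" using end0 b by simp
  obtain K where K: "K-lipschitz_on {a..b} f" using lip by blast
  define \<mu> where "\<mu> = - (INF x\<in>{a..b}. f x)"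
  note P = ab K fa fb neg' \<mu>_def
  obtain k where k: "budget_profile k (ereal \<mu>) (1 / (b - a))" and kP: "\<And>m. m > \<mu> \<Longrightarrow> k m = 1 / crossing_price f a b m"
    using price_profile[OF P] by blast
  have bounds: "- \<mu> \<le> f x" if "x \<in> {a..b}" for x using price_f_bounds(1)[OF P that] .
  have \<mu>0: "\<mu> > 0" by (rule price_mu_pos[OF P])
  have k0: "k m = 0" if "m \<le> \<mu>" for m using k that by (simp add: budget_profile_def)
  have price_pos: "crossing_price f a b m > 0" if "m > \<mu>" for m using price_lower[OF P that] ab by simp
  show thesis
  proof (rule that[of k])
    show "budget_profile k (mu_plus f a \<beta>) (if \<beta> = \<infinity> then 0 else 1 / (real_of_ereal \<beta> - a))"
      using k b by (simp add: mu_plus_def \<mu>_def)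
  next
    fix m L :: real
    assume km: "k m \<le> 1 / L" and L: "0 < L"
    \<comment> \<open>Below the threshold, continuity of \<open>k\<close> at \<open>\<mu>\<close>, where \<open>k\<close> vanishes, supplies \<open>m'\<close>.\<close>
    have "\<exists>m'\<ge>m. m' > \<mu> \<and> k m' \<le> 1 / L"
    proof (cases "m > \<mu>")
      case True then show ?thesis using km by auto
    next
      case False
      have "isCont k \<mu>" using k by (simp add: budget_profile_def continuous_on_eq_continuous_at)
      then have "\<forall>\<^sub>F z in at \<mu>. k z < 1 / L"
        using k0[of \<mu>] L by (intro order_tendstoD[where f=k and y="k \<mu>"]) (auto simp: isCont_def)
      then have "\<forall>\<^sub>F z in at_right \<mu>. k z < 1 / L \<and> z > \<mu>"
        by (auto simp: eventually_at_filter elim: eventually_mono)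
      then obtain m' where "k m' < 1 / L" "m' > \<mu>"
        using eventually_happens'[OF trivial_limit_at_right_real] by blast
      then show ?thesis using False by (intro exI[of _ m']) auto
    qed
    then obtain m' where m': "m \<le> m'" "\<mu> < m'" "k m' \<le> 1 / L" by blast
    have Lprice: "L \<le> integral {a..b} (\<lambda>x. m' / (m' + f x))"
      using m'(3) kP[OF m'(2)] price_pos[OF m'(2)] L by (simp add: crossing_price_def field_simps)
    show "budget_confines f a \<beta> m L"
      unfolding budget_confines_def
    proof (intro allI impI)
      fix u y :: "real \<Rightarrow> real" and J T N
      assume car: "caratheodory_solution f u J y" and J: "{..T} \<subseteq> J" and lim: "(y \<longlongrightarrow> a) at_bot"
        and N: "negligible N" and "\<forall>t. t \<notin> N \<longrightarrow> \<bar>u t\<bar> < m"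
          "\<forall>p q. u absolutely_integrable_on {p..q}" "\<forall>p q. integral {p..q} (\<lambda>t. \<bar>u t\<bar>) \<le> L"
      note um = this(5)[rule_format] and uint = this(6)[rule_format] and uL = this(7)[rule_format]
      have less: "m' / (m' + f x) * (f x + u t) < \<bar>u t\<bar>" if x: "a < x" "x < b" "t \<notin> N" for x t
      proof -
        have "0 < m' + f x" "\<bar>u t\<bar> < m'" using bounds[of x] m' um[of t] x by auto
        then show ?thesis using neg'[OF x(1,2)] by (intro optimal_weight_inequality)
      qed
      from cost_barrier[OF car J lim ab price_integrand_cont[OF P m'(2)] N less uint uL Lprice]
      have "\<exists>B'>a. B' < b \<and> (\<forall>t\<in>J. y t \<le> B')" .
      then show "\<exists>hi. ereal hi < \<beta> \<and> (\<forall>t\<in>J. y t \<le> hi)" using b by auto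
    qed
  next
    fix m L :: real assume km: "k m = 1 / L" and L: "0 < L"
    have m\<mu>: "m > \<mu>" using km L k0[of m] by (cases "m \<le> \<mu>") auto
    have m0: "m > 0" using m\<mu> \<mu>0 by simp
    have PL: "crossing_price f a b m = L" using km kP[OF m\<mu>] by simp
    define T where "T = L / m"
    have T: "T = crossing_price f a b m / m" by (simp add: T_def PL)
    have "pulse_escapes f a m T"
      unfolding pulse_escapes_def
    proof (intro allI impI)
      fix u assume u: "\<forall>t<0. u t = 0" "\<forall>t. 0 < t \<and> t < T \<longrightarrow> u t = m" "\<forall>t>T. u t = 0"
        "\<forall>p q. u absolutely_integrable_on {p..q}"
      have "\<exists>y. caratheodory_solution f u UNIV y \<and> (y \<longlongrightarrow> a) at_bot \<and> (y \<longlongrightarrow> b) at_top"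
      proof (rule bang_bang_transit[OF ab f fa fb m0 _ T])
        show "m + f x > 0" if "x \<in> {a..b}" for x using bounds[OF that] m\<mu> by linarith
      qed (use u in auto)
      moreover have "b \<noteq> a" using ab by simp
      ultimately show "\<exists>y b. b \<noteq> a \<and> caratheodory_solution f u UNIV y \<and> (y \<longlongrightarrow> a) at_bot \<and> (y \<longlongrightarrow> b) at_top"
        by blast
    qed
    moreover have "T > 0" "m * T = L" using m0 L by (auto simp: T_def)
    ultimately show "\<exists>T>0. 0 < m \<and> m * T = L \<and> pulse_escapes f a m T" using m0 by blast
  qed
qed

text \<open>The lower bound for \<open>y\<close> is the upper bound for \<open>- y\<close>, a solution of the reflected equation; with both
bounds the solution is global, and the two one-sided limits enclose \<open>a\<close>.\<close>

lemma two_sided_confinement_prevents_tipping: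
  fixes f lam :: "real \<Rightarrow> real" and a m L :: real and \<alpha> \<beta> :: ereal
  defines "f' \<equiv> \<lambda>x. - f (- x)"
  assumes fc: "continuous_on UNIV f" and lip: "\<And>p q. \<exists>K. K-lipschitz_on {p..q} f"
    and neg: "\<And>x. a < x \<Longrightarrow> ereal x < \<beta> \<Longrightarrow> f x < 0"
    and neg': "\<And>x. - a < x \<Longrightarrow> ereal x < - \<alpha> \<Longrightarrow> f' x < 0"
    and right: "budget_confines f a \<beta> m L" and left: "budget_confines f' (- a) (- \<alpha>) m L"
    and lam: "lam \<in> Lambda L"
    and small: "\<And>t. lam differentiable (at t) \<Longrightarrow> \<bar>deriv lam t\<bar> < m"
  shows "\<not> induces_tipping f a lam"
proof
  assume "induces_tipping f a lam"
  then obtain J y where pull: "pullback_solution f (deriv lam) a J y"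
    and bad: "\<not> (J = UNIV \<and> (y \<longlongrightarrow> a) at_top)" by (auto simp: induces_tipping_def)
  define N where "N = {t. \<not> lam differentiable (at t)}"
  have sm: "\<forall>t. t \<notin> N \<longrightarrow> \<bar>deriv lam t\<bar> < m" using small by (simp add: N_def)
  then have sm': "\<forall>t. t \<notin> N \<longrightarrow> \<bar>- deriv lam t\<bar> < m" by simp
  obtain C where C: "C-lipschitz_on UNIV lam" using lam by (auto simp: Lambda_def)
  have N: "negligible N" unfolding N_def by (rule lipschitz_differentiable_ae(1)[OF C])
  note uint = lipschitz_differentiable_ae(2)[OF C]
  note uint' = absolutely_integrable_neg[OF uint]
  have uL: "((\<lambda>t. \<bar>deriv lam t\<bar>) has_integral L) UNIV" using lam by (simp add: Lambda_def)
  then have uL': "((\<lambda>t. \<bar>- deriv lam t\<bar>) has_integral L) UNIV" by simp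
  have bud: "\<forall>p q. integral {p..q} (\<lambda>t. \<bar>deriv lam t\<bar>) \<le> L"
  proof (intro allI)
    fix p q
    have "integral {p..q} (\<lambda>t. \<bar>deriv lam t\<bar>) \<le> integral UNIV (\<lambda>t. \<bar>deriv lam t\<bar>)"
      using uint[of p q] uL by (intro integral_subset_le) (auto simp: absolutely_integrable_on_def)
    then show "integral {p..q} (\<lambda>t. \<bar>deriv lam t\<bar>) \<le> L" using uL by (simp add: integral_unique)
  qed
  then have bud': "\<forall>p q. integral {p..q} (\<lambda>t. \<bar>- deriv lam t\<bar>) \<le> L" by simp
  have max: "maximal_solution f (deriv lam) J y" and lim: "(y \<longlongrightarrow> a) at_bot"
    using pull by (auto simp: pullback_solution_def)
  obtain T where T: "{..T} \<subseteq> J" using pull by (auto simp: pullback_solution_def)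
  have car: "caratheodory_solution f (deriv lam) J y" using max by (simp add: maximal_solution_def)
  have car': "caratheodory_solution f' (\<lambda>t. - deriv lam t) J (\<lambda>t. - y t)"
    unfolding f'_def by (rule caratheodory_solution_reflect[OF car])
  have lim': "((\<lambda>t. - y t) \<longlongrightarrow> - a) at_bot" using lim by (rule tendsto_minus)
  obtain hi where hi: "ereal hi < \<beta>" "\<forall>t\<in>J. y t \<le> hi"
    using right[unfolded budget_confines_def, rule_format, OF car T lim N sm[rule_format] uint bud[rule_format]]
    by blast
  obtain lo where lo: "ereal lo < - \<alpha>" "\<forall>t\<in>J. - y t \<le> lo"
    using left[unfolded budget_confines_def, rule_format, OF car' T lim' N sm'[rule_format] uint' bud'[rule_format]]
    by blast
  have JU: "J = UNIV"
  proof (rule bounded_maximal_solution_is_global[OF max T _ lip uint])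
    fix t assume "t \<in> J"
    then show "y t \<in> {- lo..hi}" using lo(2) hi(2) by force
  qed
  have f'c: "continuous_on UNIV f'"
    unfolding f'_def
    by (intro continuous_on_minus continuous_on_compose2[OF fc] continuous_on_minus continuous_on_id) auto
  have negh: "f x < 0" if "a < x" "x \<le> hi" for x
  proof (rule neg[OF that(1)])
    have "ereal x \<le> ereal hi" using that(2) by simp
    then show "ereal x < \<beta>" using hi(1) by (rule le_less_trans)
  qed
  have negl: "f' x < 0" if "- a < x" "x \<le> lo" for x
  proof (rule neg'[OF that(1)])
    have "ereal x \<le> ereal lo" using that(2) by simp
    then show "ereal x < - \<alpha>" using lo(1) by (rule le_less_trans)
  qed
  have yhi: "y t \<le> hi" and ylo: "- y t \<le> lo" for t using hi(2) lo(2) JU by auto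
  have "(y \<longlongrightarrow> a) at_top"
  proof (rule tendstoI)
    fix e :: real assume e: "e > 0"
    then have e2: "e / 2 > 0" by simp
    have "\<forall>\<^sub>F t in at_top. y t \<le> a + e / 2"
      by (rule eventually_le_of_attraction[OF car[unfolded JU] yhi fc negh uint uL e2])
    moreover have "\<forall>\<^sub>F t in at_top. - y t \<le> - a + e / 2"
      by (rule eventually_le_of_attraction[OF car'[unfolded JU] ylo f'c negl uint' uL' e2])
    ultimately show "\<forall>\<^sub>F t in at_top. dist (y t) a < e"
      by eventually_elim (use e in \<open>auto simp: dist_real_def abs_less_iff\<close>)
  qed
  then show False using bad JU by blast
qed

lemma escaping_solution_induces_tipping:
  assumes "caratheodory_solution f (deriv lam) UNIV y" "(y \<longlongrightarrow> a) at_bot" "(y \<longlongrightarrow> b) at_top" "b \<noteq> a"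
  shows "induces_tipping f a lam"
proof -
  have "pullback_solution f (deriv lam) a UNIV y"
    using assms by (auto simp: pullback_solution_def maximal_solution_def)
  moreover have "\<not> (y \<longlongrightarrow> a) at_top"
    using assms tendsto_unique[OF trivial_limit_at_top_linorder] by blast
  ultimately show ?thesis unfolding induces_tipping_def by blast
qed

lemma pulse_escapes_imp_ramp_tips:
  assumes T: "T > 0" and esc: "pulse_escapes f a m T"
  shows "induces_tipping f a (ramp m T)"
proof -
  have u: "\<forall>t<0. deriv (ramp m T) t = 0" "\<forall>t. 0 < t \<and> t < T \<longrightarrow> deriv (ramp m T) t = m"
    "\<forall>t>T. deriv (ramp m T) t = 0" "\<forall>p q. deriv (ramp m T) absolutely_integrable_on {p..q}"
    using ramp_deriv[OF T] lipschitz_differentiable_ae(2)[OF ramp_lipschitz] by auto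
  obtain y b where "b \<noteq> a" "caratheodory_solution f (deriv (ramp m T)) UNIV y"
    "(y \<longlongrightarrow> a) at_bot" "(y \<longlongrightarrow> b) at_top"
    using esc[unfolded pulse_escapes_def, rule_format, OF u[rule_format]] by blast
  then show ?thesis by (blast intro: escaping_solution_induces_tipping)
qed

lemma reflected_pulse_escapes_imp_ramp_tips:
  assumes T: "T > 0" and esc: "pulse_escapes (\<lambda>x. - f (- x)) (- a) m T"
  shows "induces_tipping f a (ramp (- m) T)"
proof -
  let ?u = "\<lambda>t. - deriv (ramp (- m) T) t"
  have u: "\<forall>t<0. ?u t = 0" "\<forall>t. 0 < t \<and> t < T \<longrightarrow> ?u t = m" "\<forall>t>T. ?u t = 0"
    using ramp_deriv[OF T, where c="- m"] by auto
  have uint: "?u absolutely_integrable_on {p..q}" for p q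
    by (rule absolutely_integrable_neg[OF lipschitz_differentiable_ae(2)[OF ramp_lipschitz]])
  obtain y b where y: "b \<noteq> - a" "caratheodory_solution (\<lambda>x. - f (- x)) ?u UNIV y"
    "(y \<longlongrightarrow> - a) at_bot" "(y \<longlongrightarrow> b) at_top"
    using esc[unfolded pulse_escapes_def, rule_format, OF u[rule_format] uint] by blast
  show ?thesis
  proof (rule escaping_solution_induces_tipping)
    show "caratheodory_solution f (deriv (ramp (- m) T)) UNIV (\<lambda>t. - y t)"
      using caratheodory_solution_reflect[OF y(2)] by simp
    show "((\<lambda>t. - y t) \<longlongrightarrow> a) at_bot" using tendsto_minus[OF y(3)] by simp
    show "((\<lambda>t. - y t) \<longlongrightarrow> - b) at_top" by (rule tendsto_minus[OF y(4)])
    show "- b \<noteq> a" using y(1) by auto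
  qed
qed

section \<open>The critical rate\<close>

lemma frontier_of_open_interval:
  fixes \<alpha> \<beta> :: ereal
  assumes S: "S = {x. \<alpha> < ereal x \<and> ereal x < \<beta>}" and a: "\<alpha> < ereal a" "ereal a < \<beta>"
  shows "\<beta> = ereal b \<Longrightarrow> b \<in> frontier S" and "\<alpha> = ereal b \<Longrightarrow> b \<in> frontier S"
proof -
  have cl: "b \<in> closure S" if "{min a b<..<max a b} \<subseteq> S" "a \<noteq> b"
  proof -
    have "closure {min a b<..<max a b} = {min a b..max a b}" using that by (intro closure_greaterThanLessThan) auto
    then show ?thesis using closure_mono[OF that(1)] by auto
  qed
  show "b \<in> frontier S" if "\<beta> = ereal b"
  proof -
    have "a < b" using a(2) that by simp
    then have "{min a b<..<max a b} \<subseteq> S"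
      using less_trans[OF a(1)] that by (auto simp: S)
    moreover have "b \<notin> S" using that by (simp add: S)
    ultimately show ?thesis using cl \<open>a < b\<close> interior_subset by (auto simp: frontier_def)
  qed
  show "b \<in> frontier S" if "\<alpha> = ereal b"
  proof -
    have ba: "b < a" using a(1) that by simp
    have "ereal x < \<beta>" if "x < a" for x
    proof -
      have "ereal x < ereal a" using that by simp
      then show ?thesis using a(2) by (rule less_trans)
    qed
    then have "{min a b<..<max a b} \<subseteq> S" using ba that by (auto simp: S)
    moreover have "b \<notin> S" using that by (simp add: S)
    ultimately show ?thesis using cl ba interior_subset by (auto simp: frontier_def)
  qed
qed

lemma mu_minus_reflect: "mu_minus f a \<alpha> = mu_plus (\<lambda>x. - f (- x)) (- a) (- \<alpha>)"
proof (cases "\<alpha> = -\<infinity>")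
  case False
  have "{-a..real_of_ereal (- \<alpha>)} = uminus ` {real_of_ereal \<alpha>..a}" by simp
  then have "(\<lambda>x. - f (- x)) ` {-a..real_of_ereal (- \<alpha>)} = (\<lambda>x. - f (- x)) ` uminus ` {real_of_ereal \<alpha>..a}"
    by (rule arg_cong)
  also have "\<dots> = uminus ` f ` {real_of_ereal \<alpha>..a}" by (simp only: image_image minus_minus)
  finally have im: "(\<lambda>x. - f (- x)) ` {-a..real_of_ereal (- \<alpha>)} = uminus ` f ` {real_of_ereal \<alpha>..a}" .
  have "(INF x\<in>{-a..real_of_ereal (- \<alpha>)}. - f (- x)) = - (SUP x\<in>{real_of_ereal \<alpha>..a}. f x)"
    unfolding im by (simp add: Inf_real_def image_image)
  then show ?thesis using False by (simp add: mu_minus_def mu_plus_def ereal_uminus_eq_reorder)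
qed (simp add: mu_minus_def mu_plus_def)

text \<open>The reciprocal price at infinite rate is the reciprocal distance to the nearer boundary point,
with \<open>0\<close> standing for an infinite distance.\<close>

lemma inverse_basin_radius:
  assumes "\<alpha> < ereal a" "ereal a < \<beta>" "\<alpha> \<noteq> -\<infinity> \<or> \<beta> \<noteq> \<infinity>"
  shows "basin_radius a \<alpha> \<beta> > 0"
    and "max (if \<beta> = \<infinity> then 0 else 1 / (real_of_ereal \<beta> - a))
       (if - \<alpha> = \<infinity> then 0 else 1 / (real_of_ereal (- \<alpha>) - - a)) = 1 / basin_radius a \<alpha> \<beta>"
  using assms by (cases \<alpha>; cases \<beta>; auto simp: basin_radius_def min_def max_def field_simps)+

lemma mu_finite:
  assumes "\<alpha> \<noteq> -\<infinity> \<or> \<beta> \<noteq> \<infinity>"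
  shows "\<exists>\<mu>. mu f a \<alpha> \<beta> = ereal \<mu>"
  using assms by (cases "\<alpha> = -\<infinity>"; cases "\<beta> = \<infinity>") (auto simp: mu_def mu_minus_def mu_plus_def min_def)

theorem theorem2:
  fixes f :: "real \<Rightarrow> real" and a :: real and \<alpha> \<beta> :: ereal
  assumes "C2_on f UNIV"
    and "hyperbolic f a" and "attracting f a"
    and "basin f a = {x. \<alpha> < ereal x \<and> ereal x < \<beta>}"
    and "\<alpha> < ereal a" and "ereal a < \<beta>"
    and "card (frontier (basin f a)) \<in> {1, 2}"
    and "\<forall>p\<in>frontier (basin f a). hyperbolic f p \<and> \<not> stable f p"
  shows "\<exists>m_c :: real \<Rightarrow> real.
    (\<forall>L > basin_radius a \<alpha> \<beta>.
       mu f a \<alpha> \<beta> < ereal (m_c L) \<and>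
       (\<forall>lam\<in>Lambda L. induces_tipping f a lam \<longrightarrow>
          (\<exists>t. lam differentiable (at t) \<and> m_c L \<le> \<bar>deriv lam t\<bar>)) \<and>
       (\<exists>lam\<in>Lambda L. induces_tipping f a lam \<and>
          (\<exists>t. lam differentiable (at t) \<and> \<bar>deriv lam t\<bar> = m_c L) \<and>
          (\<forall>t. lam differentiable (at t) \<longrightarrow> \<bar>deriv lam t\<bar> \<le> m_c L))) \<and>
    continuous_on {basin_radius a \<alpha> \<beta><..} m_c \<and>
    strict_antimono_on {basin_radius a \<alpha> \<beta><..} m_c \<and>
    filterlim m_c at_top (at_right (basin_radius a \<alpha> \<beta>)) \<and>
    ((\<lambda>L. ereal (m_c L)) \<longlongrightarrow> mu f a \<alpha> \<beta>) at_top"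
proof -
  define R where "R = basin_radius a \<alpha> \<beta>"
  define f' where "f' x = - f (- x)" for x
  note basin = assms(4) and a\<alpha> = assms(5) and a\<beta> = assms(6)
  have fc: "continuous_on UNIV f" and lip: "\<And>p q. \<exists>K. K-lipschitz_on {p..q} f"
    using C2_on_imp_lipschitz[OF assms(1)] by blast+
  have fa: "f a = 0" using assms(2) by (simp add: hyperbolic_def rest_point_def)
  have fend: "f b = 0" if "b \<in> frontier (basin f a)" for b
    using assms(8) that by (auto simp: hyperbolic_def rest_point_def)
  have fin: "\<alpha> \<noteq> -\<infinity> \<or> \<beta> \<noteq> \<infinity>"
  proof (rule ccontr)
    assume "\<not> ?thesis"
    then have "basin f a = UNIV" using basin by auto
    then show False using assms(7) by simp
  qed
  have neg: "f x < 0" if "a < x" "ereal x < \<beta>" for x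
  proof -
    have "ereal a < ereal x" using that by simp
    then have "x \<in> basin f a" using that less_trans[OF a\<alpha>] by (auto simp: basin)
    then show ?thesis using basin_points_move_left[OF lip] that by blast
  qed
  have f'c: "continuous_on UNIV f'"
    unfolding f'_def by (intro continuous_on_minus continuous_on_compose2[OF fc] continuous_on_minus continuous_on_id) auto
  have lip': "\<exists>K. K-lipschitz_on {p..q} f'" for p q
  proof -
    obtain K where K: "K-lipschitz_on {-q..-p} f" using lip by blast
    have "K-lipschitz_on {p..q} f'"
    proof (rule lipschitz_onI)
      fix x y assume "x \<in> {p..q}" "y \<in> {p..q}"
      then show "dist (f' x) (f' y) \<le> K * dist x y"
        using lipschitz_onD[OF K, of "-x" "-y"] by (simp add: f'_def dist_real_def abs_minus_commute)
    qed (rule lipschitz_on_nonneg[OF K])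
    then show ?thesis by blast
  qed
  have neg': "f' x < 0" if "- a < x" "ereal x < - \<alpha>" for x
  proof -
    have \<alpha>x: "\<alpha> < ereal (- x)" using that(2) ereal_less_uminus_reorder by force
    have "ereal (- x) < ereal a" using that(1) by simp
    then have "- x \<in> basin f a" using \<alpha>x less_trans[OF _ a\<beta>] by (auto simp: basin)
    then have "x \<in> basin f' (- a)" using basin_reflect unfolding f'_def by force
    then show ?thesis using basin_points_move_left[OF lip'] that by blast
  qed
  note fr = frontier_of_open_interval[OF basin a\<alpha> a\<beta>]
  have end1: "f b = 0" if "\<beta> = ereal b" for b using fend fr(1) that by blast
  have end2: "f' b = 0" if "- \<alpha> = ereal b" for b
  proof -
    have "\<alpha> = ereal (- b)" using that by (metis ereal_uminus_uminus uminus_ereal.simps(1))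
    then show ?thesis using fend fr(2) by (simp add: f'_def)
  qed
  have f'a: "f' (- a) = 0" using fa by (simp add: f'_def)
  have a\<alpha>': "ereal (- a) < - \<alpha>" using a\<alpha> by (metis ereal_minus_less_minus uminus_ereal.simps(1))
  obtain k1 where k1: "budget_profile k1 (mu_plus f a \<beta>) (if \<beta> = \<infinity> then 0 else 1 / (real_of_ereal \<beta> - a))"
    and conf1: "\<And>m L. k1 m \<le> 1 / L \<Longrightarrow> 0 < L \<Longrightarrow> budget_confines f a \<beta> m L"
    and esc1: "\<And>m L. k1 m = 1 / L \<Longrightarrow> 0 < L \<Longrightarrow> \<exists>T>0. 0 < m \<and> m * T = L \<and> pulse_escapes f a m T"
    using one_sided_analysis[OF fc lip fa a\<beta> neg end1] by blast
  obtain k2 where k2: "budget_profile k2 (mu_plus f' (- a) (- \<alpha>)) (if - \<alpha> = \<infinity> then 0 else 1 / (real_of_ereal (- \<alpha>) - - a))"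
    and conf2: "\<And>m L. k2 m \<le> 1 / L \<Longrightarrow> 0 < L \<Longrightarrow> budget_confines f' (- a) (- \<alpha>) m L"
    and esc2: "\<And>m L. k2 m = 1 / L \<Longrightarrow> 0 < L \<Longrightarrow> \<exists>T>0. 0 < m \<and> m * T = L \<and> pulse_escapes f' (- a) m T"
    using one_sided_analysis[OF f'c lip' f'a a\<alpha>' neg' end2] by blast
  \<comment> \<open>The cheaper side has the larger reciprocal price.\<close>
  define k where "k m = max (k1 m) (k2 m)" for m
  have mu_eq: "mu f a \<alpha> \<beta> = min (mu_plus f a \<beta>) (mu_plus f' (- a) (- \<alpha>))"
    unfolding mu_def mu_minus_reflect f'_def[abs_def] by (rule min.commute)
  obtain \<mu> where \<mu>: "mu f a \<alpha> \<beta> = ereal \<mu>" using mu_finite[OF fin] by blast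
  have R: "R > 0" unfolding R_def by (rule inverse_basin_radius(1)[OF a\<alpha> a\<beta> fin])
  have "budget_profile k (ereal \<mu>) (1 / R)"
    using budget_profile_max[OF k1 k2]
    unfolding k_def[abs_def] R_def inverse_basin_radius(2)[OF a\<alpha> a\<beta> fin] mu_eq[symmetric] \<mu> .
  from budget_profile_inverse[OF this R] obtain mc where
    mc: "\<And>L. L > R \<Longrightarrow> \<mu> < mc L" "\<And>L. L > R \<Longrightarrow> k (mc L) = 1 / L"
    and reg: "continuous_on {R<..} mc" "strict_antimono_on {R<..} mc"
      "filterlim mc at_top (at_right R)" "(mc \<longlongrightarrow> \<mu>) at_top" by blast
  have no_tip: "\<exists>t. lam differentiable (at t) \<and> mc L \<le> \<bar>deriv lam t\<bar>"
    if L: "L > R" and lam: "lam \<in> Lambda L" and tip: "induces_tipping f a lam" for L lam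
  proof (rule ccontr)
    assume "\<not> ?thesis"
    then have small: "\<bar>deriv lam t\<bar> < mc L" if "lam differentiable (at t)" for t
      using that by force
    have L0: "L > 0" using L R by simp
    have "k1 (mc L) \<le> 1 / L" "k2 (mc L) \<le> 1 / L" using mc(2)[OF L] by (auto simp: k_def)
    then have conf: "budget_confines f a \<beta> (mc L) L" "budget_confines f' (- a) (- \<alpha>) (mc L) L"
      using conf1 conf2 L0 by blast+
    have "\<not> induces_tipping f a lam"
      by (rule two_sided_confinement_prevents_tipping
          [OF fc lip neg neg'[unfolded f'_def] conf(1) conf(2)[unfolded f'_def[abs_def]] lam small])
    then show False using tip by simp
  qed
  have tip: "\<exists>lam\<in>Lambda L. induces_tipping f a lam \<and>
          (\<exists>t. lam differentiable (at t) \<and> \<bar>deriv lam t\<bar> = mc L) \<and>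
          (\<forall>t. lam differentiable (at t) \<longrightarrow> \<bar>deriv lam t\<bar> \<le> mc L)"
    if L: "L > R" for L
  proof -
    define m where "m = mc L"
    have L0: "L > 0" using L R by simp
    have "k m = 1 / L" using mc(2)[OF L] by (simp add: m_def)
    then consider "k1 m = 1 / L" | "k2 m = 1 / L" by (auto simp: k_def max_def split: if_splits)
    then have "\<exists>c T. T > 0 \<and> \<bar>c\<bar> = m \<and> m * T = L \<and> induces_tipping f a (ramp c T)"
    proof cases
      case 1
      from esc1[OF this L0] obtain T where T: "T > 0" "0 < m" "m * T = L" "pulse_escapes f a m T" by blast
      then show ?thesis using pulse_escapes_imp_ramp_tips[OF T(1,4)] by (intro exI[of _ m] exI[of _ T]) auto
    next
      case 2
      from esc2[OF this L0] obtain T where T: "T > 0" "0 < m" "m * T = L" "pulse_escapes f' (- a) m T" by blast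
      then show ?thesis using reflected_pulse_escapes_imp_ramp_tips[OF T(1) T(4)[unfolded f'_def[abs_def]]]
        by (intro exI[of _ "- m"] exI[of _ T]) auto
    qed
    then obtain c T where c: "T > 0" "\<bar>c\<bar> = m" "m * T = L" "induces_tipping f a (ramp c T)" by blast
    have "ramp c T \<in> Lambda L" using ramp_in_Lambda[OF c(1), of c] c(2,3) by simp
    then show ?thesis
      using c(4) ramp_max_rate[OF c(1), of c] unfolding c(2) m_def by blast
  qed
  have lim: "((\<lambda>L. ereal (mc L)) \<longlongrightarrow> mu f a \<alpha> \<beta>) at_top" unfolding \<mu> using reg(4) by (simp add: lim_ereal)
  have "\<forall>L>R. mu f a \<alpha> \<beta> < ereal (mc L) \<and>
       (\<forall>lam\<in>Lambda L. induces_tipping f a lam \<longrightarrow> (\<exists>t. lam differentiable (at t) \<and> mc L \<le> \<bar>deriv lam t\<bar>)) \<and>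
       (\<exists>lam\<in>Lambda L. induces_tipping f a lam \<and>
          (\<exists>t. lam differentiable (at t) \<and> \<bar>deriv lam t\<bar> = mc L) \<and>
          (\<forall>t. lam differentiable (at t) \<longrightarrow> \<bar>deriv lam t\<bar> \<le> mc L))"
    using mc(1) no_tip tip by (simp add: \<mu>)
  then show ?thesis using reg(1,2,3) lim unfolding R_def by blast
qed

end
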